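(* Let $d\ge2$ and let $\{\Pi_j\}$ be a minimal informationally complete (IC) measurement on a $d$-dimensional quantum system with average purity $\wp$. Let $N\ge1$ be the number of independent repetitions of the measurement. Then for every unbiased estimator $\hat\rho$ (based on the $N$ outcomes) and every state $\rho$, the maximal scaled mean square error over the states unitarily equivalent to $\rho$ satisfies $$\max_{U}\ \mathcal{E}_{\hat\rho}(U\rho U^\dagger)\;\ge\;\frac{(d^2-1)^2}{d^2\wp-d}-\Bigl[\tr(\rho^2)-\frac1d\Bigr],$$ where the maximum is over all unitary operators $U$ on $\mathbb{C}^d$. Moreover, this bound can be saturated (i.e. there is an unbiased estimator for which equality holds for every state $\rho$) if and only if $\{\Pi_j\}$ is a generalized SIC measurement.
   Context: A state $\rho$ is a positive semidefinite operator of trace $1$ on $\mathbb{C}^d$. A measurement is a finite set of positive semidefinite operators $\Pi_j$ on $\mathbb{C}^d$ with $\sum_j\Pi_j=1$ (the identity operator); on state $\rho$ outcome $j$ occurs with probability $p_j=\tr(\Pi_j\rho)$. The measurement is informationally complete (IC) if the $\Pi_j$ span the whole operator space, and minimal IC if in addition it has exactly $d^2$ outcomes. The purity of $\Pi_j$ is $\wp_j=\tr(\Pi_j^2)/[\tr(\Pi_j)]^2$, and the average purity of the measurement is $\wp=\sum_j\tr(\Pi_j)\wp_j/d$. The measurement is performed independently on $N$ copies of the unknown state. An estimator $\hat\rho$ is a map from sequences of $N$ outcomes to Hermitian operators; it is unbiased if its expectation equals $\sigma$ whenever the true state is $\sigma$, for every state $\sigma$. Its scaled mean square error at the state $\sigma$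 is $\mathcal{E}_{\hat\rho}(\sigma)=N\,\mathbb{E}_\sigma\bigl[\tr\{(\hat\rho-\sigma)^2\}\bigr]$. A measurement $\{\Pi_j=P_j/d\}$ is a generalized SIC measurement if it is IC and $\tr(P_jP_k)=\alpha\delta_{jk}+\zeta$ for all $j,k$, for some real constants $\alpha,\zeta$. *)

theory Defs
  imports "HOL-Probability.Probability"
begin

definition mat_adj :: "complex^'n^'m \<Rightarrow> complex^'m^'n" where
  "mat_adj A = (\<chi> i j. cnj (A $ j $ i))"

definition hermitian :: "complex^'n^'n \<Rightarrow> bool" where
  "hermitian A \<longleftrightarrow> mat_adj A = A"

definition unitary :: "complex^'n^'n \<Rightarrow> bool" where
  "unitary U \<longleftrightarrow> mat_adj U ** U = mat 1 \<and> U ** mat_adj U = mat 1"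

definition psd :: "complex^'n^'n \<Rightarrow> bool" where
  "psd A \<longleftrightarrow> hermitian A \<and> (\<forall>x. 0 \<le> Re (\<Sum>i\<in>UNIV. cnj (x $ i) * (A *v x) $ i))"

definition state :: "complex^'n^'n \<Rightarrow> bool" where
  "state \<rho> \<longleftrightarrow> psd \<rho> \<and> trace \<rho> = 1"

text \<open>A measurement is a family of operators indexed by a finite type of outcomes.\<close>

definition measurement :: "('k::finite \<Rightarrow> complex^'n^'n) \<Rightarrow> bool" where
  "measurement M \<longleftrightarrow> (\<forall>j. psd (M j)) \<and> (\<Sum>j\<in>UNIV. M j) = mat 1"

text \<open>The operators span the operator space over the complex numbers; \<^const>\<open>span\<close> would be
  the real span.\<close>

definition info_complete :: "('k::finite \<Rightarrow> complex^'n^'n) \<Rightarrow> bool" where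
  "info_complete M \<longleftrightarrow> measurement M \<and>
     (\<forall>A. \<exists>c :: 'k \<Rightarrow> complex. A = (\<Sum>j\<in>UNIV. \<chi> a b. c j * M j $ a $ b))"

definition minimal_info_complete :: "('k::finite \<Rightarrow> complex^'n^'n) \<Rightarrow> bool" where
  "minimal_info_complete M \<longleftrightarrow> info_complete M \<and> CARD('k) = CARD('n)\<^sup>2"

text \<open>Traces of Hermitian operators and of products of two of them are real, so taking
  the real part below loses nothing.\<close>

definition purity :: "complex^'n^'n \<Rightarrow> real" where
  "purity A = Re (trace (A ** A)) / (Re (trace A))\<^sup>2"

definition average_purity :: "('k::finite \<Rightarrow> complex^'n^'n) \<Rightarrow> real" where
  "average_purity M = (\<Sum>j\<in>UNIV. Re (trace (M j)) * purity (M j)) / real CARD('n)"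

text \<open>For a measurement and a state the weights are nonnegative and sum to one, so
  \<^const>\<open>embed_pmf\<close> yields the distribution with exactly these outcome probabilities.\<close>

definition outcome_pmf :: "('k::finite \<Rightarrow> complex^'n^'n) \<Rightarrow> complex^'n^'n \<Rightarrow> 'k pmf" where
  "outcome_pmf M \<rho> = embed_pmf (\<lambda>j. Re (trace (M j ** \<rho>)))"

definition sample_pmf ::
  "('k::finite \<Rightarrow> complex^'n^'n) \<Rightarrow> nat \<Rightarrow> complex^'n^'n \<Rightarrow> 'k list pmf" where
  "sample_pmf M N \<rho> = replicate_pmf N (outcome_pmf M \<rho>)"

text \<open>An estimator is a function on outcome lists; only lists of length \<open>N\<close> matter.\<close>

definition estimator :: "nat \<Rightarrow> ('k list \<Rightarrow> complex^'n^'n) \<Rightarrow> bool" where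
  "estimator N est \<longleftrightarrow> (\<forall>xs. length xs = N \<longrightarrow> hermitian (est xs))"

definition unbiased_estimator ::
  "('k::finite \<Rightarrow> complex^'n^'n) \<Rightarrow> nat \<Rightarrow> ('k list \<Rightarrow> complex^'n^'n) \<Rightarrow> bool" where
  "unbiased_estimator M N est \<longleftrightarrow> estimator N est \<and>
     (\<forall>\<sigma>. state \<sigma> \<longrightarrow> measure_pmf.expectation (sample_pmf M N \<sigma>) est = \<sigma>)"

definition scaled_mse ::
  "('k::finite \<Rightarrow> complex^'n^'n) \<Rightarrow> nat \<Rightarrow> ('k list \<Rightarrow> complex^'n^'n) \<Rightarrow> complex^'n^'n \<Rightarrow> real" where
  "scaled_mse M N est \<sigma> = real N *
     measure_pmf.expectation (sample_pmf M N \<sigma>)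
       (\<lambda>xs. Re (trace ((est xs - \<sigma>) ** (est xs - \<sigma>))))"

text \<open>\<open>m\<close> is the maximum (attained, not just a supremum) of the scaled mean square error
  over the unitary orbit of \<open>\<rho>\<close>.\<close>

definition is_max_scaled_mse ::
  "('k::finite \<Rightarrow> complex^'n^'n) \<Rightarrow> nat \<Rightarrow> ('k list \<Rightarrow> complex^'n^'n) \<Rightarrow> complex^'n^'n
    \<Rightarrow> real \<Rightarrow> bool" where
  "is_max_scaled_mse M N est \<rho> m \<longleftrightarrow>
     (\<exists>U. is_arg_max (\<lambda>U. scaled_mse M N est (U ** \<rho> ** mat_adj U)) unitary U \<and>
          m = scaled_mse M N est (U ** \<rho> ** mat_adj U))"

definition generalized_SIC :: "('k::finite \<Rightarrow> complex^'n^'n) \<Rightarrow> bool" where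
  "generalized_SIC M \<longleftrightarrow> info_complete M \<and>
     (\<exists>P. (\<forall>j. M j = (1 / real CARD('n)) *\<^sub>R P j) \<and>
        (\<exists>\<alpha> \<zeta> :: real. \<forall>j k.
           trace (P j ** P k) = complex_of_real (\<alpha> * (if j = k then 1 else 0) + \<zeta>)))"

definition mse_bound :: "('k::finite \<Rightarrow> complex^'n^'n) \<Rightarrow> complex^'n^'n \<Rightarrow> real" where
  "mse_bound M \<rho> =
     ((real CARD('n))\<^sup>2 - 1)\<^sup>2 / ((real CARD('n))\<^sup>2 * average_purity M - real CARD('n))
     - (Re (trace (\<rho> ** \<rho>)) - 1 / real CARD('n))"

end

theory Submission
  imports Defs
begin

text \<open>
  Hermitian operators form a real inner product space, and a minimal informationally complete
  measurement \<open>M\<close> is a basis of it with dual basis \<open>\<Theta>\<close>. An unbiased estimator differs from linear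
  inversion (the sample mean of \<open>\<Theta>\<close>) by a statistic of mean zero at every state; differentiating
  this identity shows that the difference is uncorrelated with linear inversion, whose scaled mean
  square error at \<open>\<sigma>\<close> is \<open>\<Sum>\<^sub>j tr(M\<^sub>j \<sigma>) tr(\<Theta>\<^sub>j\<^sup>2) - tr(\<sigma>\<^sup>2)\<close>. Averaging over a finite
  unitary 1-design replaces \<open>\<sigma>\<close> by the maximally mixed state in the first term, and Cauchy--Schwarz
  applied to the traceless parts of \<open>M\<^sub>j\<close> and \<open>\<Theta>\<^sub>j\<close>, weighted by \<open>tr(M\<^sub>j)\<close>, bounds that
  term by the average purity. Saturation at all states forces \<open>tr(\<Theta>\<^sub>j\<^sup>2)\<close> to be constant and the
  traceless parts to be proportional, which together say that \<open>M\<close> is a generalized SIC.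
\<close>

section \<open>Hermitian and positive operators\<close>

lemma mat_adj_nth [simp]: "mat_adj A $ i $ j = cnj (A $ j $ i)"
  by (simp add: mat_adj_def)

lemma mat_adj_mat_adj [simp]: "mat_adj (mat_adj A) = A"
  by (simp add: vec_eq_iff)

lemma mat_adj_mult: "mat_adj (A ** B) = mat_adj B ** mat_adj A"
  by (simp add: vec_eq_iff matrix_matrix_mult_def mult.commute)

lemma hermitian_iff: "hermitian A \<longleftrightarrow> (\<forall>i j. A $ i $ j = cnj (A $ j $ i))"
  unfolding hermitian_def vec_eq_iff mat_adj_nth by (auto dest: sym)

lemma hermitian_diff: "hermitian A \<Longrightarrow> hermitian B \<Longrightarrow> hermitian (A - B)"
  by (simp add: hermitian_def vec_eq_iff)

lemma hermitian_add: "hermitian A \<Longrightarrow> hermitian B \<Longrightarrow> hermitian (A + B)"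
  by (simp add: hermitian_def vec_eq_iff)

lemma hermitian_scaleR: "hermitian A \<Longrightarrow> hermitian (c *\<^sub>R A)"
  by (simp add: hermitian_def vec_eq_iff)

lemma hermitian_mat_1: "hermitian (mat 1)"
  by (auto simp: hermitian_def vec_eq_iff mat_def)

lemma hermitian_zero: "hermitian 0"
  by (simp add: hermitian_def vec_eq_iff)

lemma hermitian_sum: "(\<And>i. i \<in> I \<Longrightarrow> hermitian (f i)) \<Longrightarrow> hermitian (\<Sum>i\<in>I. f i)"
  by (induction I rule: infinite_finite_induct) (auto intro: hermitian_add hermitian_zero)

lemma hermitian_sum_list: "(\<And>x. hermitian (f x)) \<Longrightarrow> hermitian (sum_list (map f xs))"
  by (induction xs) (auto intro: hermitian_add hermitian_zero)

text \<open>The Euclidean inner product on matrices is the real part of the Hilbert-Schmidt product,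
  so norms, adjoints and orthonormal bases of the ambient Euclidean space apply to
  operators.\<close>

lemma inner_mat_conv_trace: "A \<bullet> B = Re (trace (A ** mat_adj B))"
  by (simp add: inner_vec_def trace_def matrix_matrix_mult_def inner_complex_def)

lemma inner_hermitian: "hermitian B \<Longrightarrow> A \<bullet> B = Re (trace (A ** B))"
  by (simp add: inner_mat_conv_trace hermitian_def)

lemma inner_mat_1: "A \<bullet> mat 1 = Re (trace A)"
  by (simp add: inner_hermitian hermitian_mat_1)

text \<open>The adjoint reverses the product and cyclicity of the trace undoes the reversal, so the
  trace equals its own conjugate.\<close>

lemma trace_mult_hermitian_real:
  assumes "hermitian A" "hermitian B"
  shows "trace (A ** B) = complex_of_real (A \<bullet> B)"
proof -
  have "cnj (trace (A ** B)) = trace (mat_adj (A ** B))"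
    by (simp add: trace_def)
  also have "\<dots> = trace (A ** B)"
    using assms by (metis mat_adj_mult hermitian_def trace_mul_sym)
  finally have "trace (A ** B) \<in> \<real>"
    by (simp add: Reals_cnj_iff)
  then show ?thesis
    using inner_hermitian[OF assms(2), of A] of_real_Re by metis
qed

lemma trace_hermitian_real:
  assumes "hermitian A"
  shows "trace A = complex_of_real (A \<bullet> mat 1)"
  using trace_mult_hermitian_real[OF assms hermitian_mat_1] by simp

lemma inner_mat_adj: "mat_adj A \<bullet> mat_adj B = A \<bullet> B"
  unfolding inner_vec_def mat_adj_nth by (subst sum.swap) (simp add: inner_complex_def)

lemma inner_conj: "(U ** A ** mat_adj U) \<bullet> B = A \<bullet> (mat_adj U ** B ** U)"
proof -
  have "trace (U ** A ** mat_adj U ** mat_adj B) = trace (U ** (A ** mat_adj U ** mat_adj B))"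
    by (simp add: matrix_mul_assoc)
  also have "\<dots> = trace (A ** mat_adj U ** mat_adj B ** U)"
    by (rule trace_mul_sym)
  finally show ?thesis
    by (simp add: inner_mat_conv_trace mat_adj_mult matrix_mul_assoc)
qed

section \<open>Rank-one operators and the cone of positive operators\<close>

definition outer :: "complex^'n \<Rightarrow> complex^'n^'n" where
  "outer x = (\<chi> a b. x $ a * cnj (x $ b))"

lemma hermitian_outer: "hermitian (outer x)"
  by (simp add: hermitian_iff outer_def)

lemma inner_outer:
  "A \<bullet> outer x = Re (\<Sum>i\<in>UNIV. cnj (x $ i) * (A *v x) $ i)"
  by (simp add: inner_vec_def outer_def matrix_vector_mult_def sum_distrib_left inner_complex_def
      algebra_simps)

lemma psd_iff: "psd A \<longleftrightarrow> hermitian A \<and> (\<forall>x. 0 \<le> A \<bullet> outer x)"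
  by (simp add: psd_def inner_outer)

lemma cnj_mult_self: "cnj z * z = complex_of_real ((cmod z)\<^sup>2)"
  using complex_norm_square[of z] by (simp only: mult.commute)

lemma inner_outer_outer: "outer v \<bullet> outer x = (cmod (\<Sum>i\<in>UNIV. cnj (v $ i) * x $ i))\<^sup>2"
proof -
  let ?s = "\<Sum>i\<in>UNIV. cnj (v $ i) * x $ i"
  have "(outer v *v x) $ i = v $ i * ?s" for i
    by (simp add: outer_def matrix_vector_mult_def sum_distrib_left mult.assoc)
  then have "(\<Sum>i\<in>UNIV. cnj (x $ i) * (outer v *v x) $ i) = cnj ?s * ?s"
    unfolding cnj_sum sum_distrib_right
    by (intro sum.cong refl) (simp only: complex_cnj_mult complex_cnj_cnj mult_ac)
  also have "\<dots> = complex_of_real ((cmod ?s)\<^sup>2)"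
    by (rule cnj_mult_self)
  finally show ?thesis
    by (simp add: inner_outer)
qed

text \<open>Moving one coordinate makes the quadratic form an explicit quadratic in
  \<open>z\<close>; the two cross terms are conjugate because \<open>A\<close> is Hermitian.
  Suitable \<open>z\<close> give the zero-row argument, polarization and the Schur
  complement.\<close>

lemma inner_outer_add_axis:
  assumes "hermitian A"
  shows "A \<bullet> outer (x + axis a z) =
    A \<bullet> outer x + 2 * Re (cnj z * (A *v x) $ a) + (cmod z)\<^sup>2 * Re (A $ a $ a)"
proof -
  have ax: "(A *v axis a z) $ i = A $ i $ a * z" for i
    by (simp add: matrix_vector_mult_def axis_def if_distrib cong: if_cong)
  have 1: "(\<Sum>i\<in>UNIV. cnj (axis a z $ i) * w i) = cnj z * w a" for w :: "'a \<Rightarrow> complex"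
    by (simp add: axis_def if_distrib if_distribR cong: if_cong)
  have 2: "(\<Sum>i\<in>UNIV. cnj (x $ i) * (A $ i $ a * z)) = z * cnj ((A *v x) $ a)"
  proof -
    have "cnj (A $ a $ i) = A $ i $ a" for i
      using assms by (metis hermitian_iff)
    then show ?thesis
      by (simp add: matrix_vector_mult_def sum_distrib_left mult_ac)
  qed
  have "A \<bullet> outer (x + axis a z) = Re (\<Sum>i\<in>UNIV. cnj (x $ i) * (A *v x) $ i)
      + Re (\<Sum>i\<in>UNIV. cnj (x $ i) * (A $ i $ a * z))
      + Re (\<Sum>i\<in>UNIV. cnj (axis a z $ i) * (A *v x) $ i)
      + Re (\<Sum>i\<in>UNIV. cnj (axis a z $ i) * (A $ i $ a * z))"
    by (simp only: inner_outer matrix_vector_right_distrib ax vector_add_component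
        complex_cnj_add distrib_left distrib_right sum.distrib plus_complex.sel)
  also have "\<dots> = A \<bullet> outer x + 2 * Re (cnj z * (A *v x) $ a) + Re (cnj z * (A $ a $ a * z))"
    unfolding 1 2 by (simp add: inner_outer)
  also have "Re (cnj z * (A $ a $ a * z)) = (cmod z)\<^sup>2 * Re (A $ a $ a)"
  proof -
    have "cnj z * (A $ a $ a * z) = complex_of_real ((cmod z)\<^sup>2) * A $ a $ a"
      unfolding cnj_mult_self[symmetric] by (simp only: mult_ac)
    then show ?thesis
      by (simp only: times_complex.sel Re_complex_of_real Im_complex_of_real)
  qed
  finally show ?thesis .
qed

lemma mult_axis_component: "(A *v axis a z) $ i = A $ i $ a * (z :: complex)"
  by (simp add: matrix_vector_mult_def axis_def if_distrib cong: if_cong)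

lemma inner_outer_axis: "A \<bullet> outer (axis a 1) = Re (A $ a $ a)"
proof -
  have "A \<bullet> outer (axis a 1) = Re (\<Sum>i\<in>UNIV. if i = a then A $ i $ a else 0)"
    unfolding inner_outer mult_axis_component
    by (rule arg_cong[where f = Re], rule sum.cong) (auto simp: axis_def)
  then show ?thesis
    by simp
qed

lemma psd_diag_nonneg: "psd A \<Longrightarrow> 0 \<le> Re (A $ a $ a)"
  by (metis psd_iff inner_outer_axis)

text \<open>With no quadratic term along axis \<open>a\<close>, a nonzero cross term would drive the
  form below zero.\<close>

lemma psd_zero_diag_imp_zero:
  assumes "psd A" "Re (A $ a $ a) = 0"
  shows "A $ a $ b = 0"
proof (rule ccontr)
  assume nz: "A $ a $ b \<noteq> 0"
  define r where "r = (cmod (A $ a $ b))\<^sup>2"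
  have r: "r > 0"
    using nz by (simp add: r_def)
  \<comment> \<open>Chosen to make the quadratic form equal to -1.\<close>
  define t where "t = (Re (A $ b $ b) + 1) / (2 * r)"
  have "0 \<le> A \<bullet> outer (axis b 1 + axis a (- of_real t * A $ a $ b))"
    using assms by (simp add: psd_iff)
  also have "\<dots> = Re (A $ b $ b) - 2 * t * Re (cnj (A $ a $ b) * A $ a $ b)"
    using assms by (subst inner_outer_add_axis)
      (auto simp: psd_iff inner_outer_axis mult_axis_component mult.assoc)
  also have "Re (cnj (A $ a $ b) * A $ a $ b) = r"
    unfolding r_def cnj_mult_self by (rule Re_complex_of_real)
  also have "Re (A $ b $ b) - 2 * t * r = -1"
    using r by (simp add: t_def field_simps)
  finally show False by simp
qed

text \<open>Polarization: once the diagonal has no real part, the cross term isolates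
  \<open>A $ a $ b\<close>, and \<open>z = 1\<close> and \<open>z = \<i>\<close> read off its real
  and imaginary parts.\<close>

lemma hermitian_eq_0_if_outer:
  fixes A :: "complex^'n^'n"
  assumes "hermitian A" "\<And>x. A \<bullet> outer x = 0"
  shows "A = 0"
proof -
  have "A $ a $ b = 0" for a b
  proof -
    have d: "Re (A $ c $ c) = 0" for c
      using assms(2) inner_outer_axis by metis
    have "Re (cnj z * A $ a $ b) = 0" for z
      using assms(2)[of "axis b 1 + axis a z"] inner_outer_add_axis[OF assms(1), of "axis b 1" a z]
      by (simp add: inner_outer_axis mult_axis_component d)
    from this[of 1] this[of \<i>] show ?thesis
      by (simp add: complex_eq_iff)
  qed
  then show ?thesis
    by (simp add: vec_eq_iff)
qed

text \<open>Induction on the support of \<open>A\<close>: subtracting the rank-one operator built from a column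
  with nonzero diagonal entry (a Schur complement) clears one row and keeps positivity.\<close>

lemma psd_inner_nonneg:
  assumes "psd A" "psd B"
  shows "0 \<le> A \<bullet> B"
proof -
  have "\<lbrakk>psd A; \<And>a b. a \<notin> S \<Longrightarrow> A $ a $ b = 0\<rbrakk> \<Longrightarrow> 0 \<le> A \<bullet> B" if "finite S" for S
    using that
  proof (induction S arbitrary: A rule: finite_induct)
    case empty
    then have "A = 0"
      by (simp add: vec_eq_iff)
    then show ?case
      by simp
  next
    case (insert a S)
    have her: "hermitian A"
      using insert.prems(1) by (simp add: psd_iff)
    show ?case
    proof (cases "Re (A $ a $ a) = 0")
      case True
      then have "A $ a $ b = 0" for b
        using psd_zero_diag_imp_zero insert.prems(1) by blast
      then have "A $ c $ b = 0" if "c \<notin> S" for b c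
        using insert.prems(2) that by (cases "c = a") auto
      then show ?thesis
        using insert.IH insert.prems(1) by blast
    next
      case False
      define r where "r = Re (A $ a $ a)"
      have r: "r > 0"
        using False psd_diag_nonneg[OF insert.prems(1), of a] by (simp add: r_def)
      have Aaa: "A $ a $ a = of_real r"
        using her by (metis Reals_cnj_iff hermitian_iff of_real_Re r_def)
      \<comment> \<open>The normalisation makes \<open>outer v\<close> agree with \<open>A\<close>
        on row and column \<open>a\<close>.\<close>
      define v where "v = (\<chi> b. A $ b $ a / of_real (sqrt r))"
      have rr: "complex_of_real (sqrt r) * of_real (sqrt r) = of_real r"
        using r by (metis of_real_mult real_sqrt_mult_self abs_of_pos)
      have v: "outer v $ b $ c = A $ b $ a * A $ a $ c / of_real r" for b c
      proof -
        have "cnj (A $ c $ a) = A $ a $ c"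
          using her by (metis hermitian_iff)
        then show ?thesis
          using rr by (simp add: outer_def v_def)
      qed
      let ?A = "A - outer v"
      have psd: "psd ?A"
        unfolding psd_iff
      proof (intro conjI allI)
        show "hermitian ?A"
          using her hermitian_outer by (rule hermitian_diff)
        fix x
        define w where "w = (A *v x) $ a"
        have "(\<Sum>i\<in>UNIV. cnj (v $ i) * x $ i) = w / of_real (sqrt r)"
        proof -
          have "cnj (A $ i $ a) = A $ a $ i" for i
            using her by (metis hermitian_iff)
          then show ?thesis
            by (simp add: v_def w_def matrix_vector_mult_def sum_divide_distrib)
        qed
        then have vx: "outer v \<bullet> outer x = (cmod w)\<^sup>2 / r"
          using r by (simp add: inner_outer_outer norm_divide power_divide)
        have "Re (cnj w * w) = (cmod w)\<^sup>2"
          unfolding cnj_mult_self by (rule Re_complex_of_real)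
        then have w2: "Re (cnj (- w / of_real r) * w) = - (cmod w)\<^sup>2 / r"
          by (simp add: Re_divide_of_real)
        \<comment> \<open>This shift of coordinate \<open>a\<close> minimises the form of
          \<open>A\<close>; the minimum is exactly the form of the Schur complement at
          \<open>x\<close>.\<close>
        have "0 \<le> A \<bullet> outer (x + axis a (- w / of_real r))"
          using insert.prems(1) by (simp add: psd_iff)
        also have "\<dots> = A \<bullet> outer x - (cmod w)\<^sup>2 / r"
          unfolding inner_outer_add_axis[OF her] w_def[symmetric] w2
          using r by (simp add: Aaa norm_divide power_divide power2_eq_square[of r])
        finally show "0 \<le> ?A \<bullet> outer x"
          by (simp add: inner_diff_left vx)
      qed
      have "?A $ c $ b = 0" if "c \<notin> S" for b c
      proof (cases "c = a")
        case True
        then show ?thesis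
          using r by (simp add: v Aaa)
      next
        case False
        then show ?thesis
          using insert.prems(2) that by (simp add: v)
      qed
      then have "0 \<le> ?A \<bullet> B"
        using insert.IH psd by blast
      moreover have "0 \<le> outer v \<bullet> B"
        using assms(2) by (simp add: psd_iff inner_commute)
      ultimately show ?thesis
        by (simp add: inner_diff_left)
    qed
  qed
  from this[of UNIV] assms(1) show ?thesis
    by simp
qed

lemma psd_outer: "psd (outer x)"
  by (simp add: psd_iff hermitian_outer inner_outer_outer)

lemma psd_scaleR: "psd A \<Longrightarrow> 0 \<le> c \<Longrightarrow> psd (c *\<^sub>R A)"
  by (simp add: psd_iff hermitian_scaleR)

lemma psd_add: "psd A \<Longrightarrow> psd B \<Longrightarrow> psd (A + B)"
  by (simp add: psd_iff hermitian_add inner_add_left)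

lemma psd_mat_1: "psd (mat 1 :: complex^'n^'n)"
proof -
  have "(mat 1 :: complex^'n^'n) \<bullet> outer x = (\<Sum>i\<in>UNIV. (cmod (x $ i))\<^sup>2)" for x :: "complex^'n"
    unfolding inner_outer matrix_vector_mul_lid Re_sum
    by (rule sum.cong) (auto simp: cmod_power2 simp flip: power2_eq_square)
  then show ?thesis
    by (simp add: psd_iff hermitian_mat_1 sum_nonneg)
qed

lemma psd_trace_eq_0:
  assumes "psd A" "A \<bullet> mat 1 = 0"
  shows "A = 0"
proof -
  have "(\<Sum>a\<in>UNIV. Re (A $ a $ a)) = 0"
    using assms(2) by (simp add: inner_mat_1 trace_def)
  then have "Re (A $ a $ a) = 0" for a
    using psd_diag_nonneg[OF assms(1)] by (simp add: sum_nonneg_eq_0_iff)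
  then show ?thesis
    using psd_zero_diag_imp_zero[OF assms(1)] by (simp add: vec_eq_iff)
qed

section \<open>States and unitary conjugation\<close>

lemma state_iff: "state \<sigma> \<longleftrightarrow> psd \<sigma> \<and> \<sigma> \<bullet> mat 1 = 1"
  unfolding state_def using trace_hermitian_real[of \<sigma>] by (auto simp: psd_def)

lemma hermitian_state: "state \<sigma> \<Longrightarrow> hermitian \<sigma>"
  by (simp add: state_def psd_def)

lemma state_convex:
  assumes "state \<sigma>" "state \<tau>" "0 \<le> t" "t \<le> 1"
  shows "state ((1 - t) *\<^sub>R \<sigma> + t *\<^sub>R \<tau>)"
  using assms by (auto simp: state_iff inner_add_left intro!: psd_add psd_scaleR)

text \<open>Every nonzero rank-one operator is a positive multiple of a state, so vanishing on
  states passes to all quadratic forms.\<close>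

lemma hermitian_eq_0_if_states:
  fixes A :: "complex^'n^'n"
  assumes "hermitian A" "\<And>\<sigma>. state \<sigma> \<Longrightarrow> A \<bullet> \<sigma> = 0"
  shows "A = 0"
proof (rule hermitian_eq_0_if_outer[OF assms(1)])
  fix x :: "complex^'n"
  let ?t = "outer x \<bullet> mat 1"
  show "A \<bullet> outer x = 0"
  proof (cases "?t = 0")
    case True
    then have "outer x = 0"
      using psd_trace_eq_0[OF psd_outer] by blast
    then show ?thesis
      by simp
  next
    case False
    then have "?t > 0"
      using psd_inner_nonneg[OF psd_outer psd_mat_1, of x] by linarith
    then have "state ((1 / ?t) *\<^sub>R outer x)"
      by (simp add: state_iff psd_scaleR psd_outer)
    from assms(2)[OF this] show ?thesis
      using False by simp
  qed
qed

lemma hermitian_conj: "hermitian A \<Longrightarrow> hermitian (U ** A ** mat_adj U)"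
  by (simp add: hermitian_def mat_adj_mult matrix_mul_assoc)

lemma conj_outer: "mat_adj U ** outer x ** U = outer (mat_adj U *v x)"
  by (simp add: vec_eq_iff outer_def matrix_matrix_mult_def matrix_vector_mult_def
      sum_distrib_left sum_distrib_right mult_ac)

text \<open>The conjugation moves onto the test vector: the form at \<open>x\<close> becomes that of
  \<rho> at \<open>mat_adj U *v x\<close>.\<close>

lemma state_conj:
  assumes "state \<rho>" "unitary U"
  shows "state (U ** \<rho> ** mat_adj U)"
proof -
  have "mat_adj U ** mat 1 ** U = mat 1"
    using assms(2) by (simp add: unitary_def)
  then show ?thesis
    using assms(1) by (simp add: state_iff psd_iff hermitian_conj inner_conj conj_outer)
qed

lemma inner_conj_unitary:
  assumes "unitary U"
  shows "(U ** \<rho> ** mat_adj U) \<bullet> (U ** \<rho> ** mat_adj U) = \<rho> \<bullet> \<rho>"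
proof -
  have "mat_adj U ** (U ** \<rho> ** mat_adj U) ** U = (mat_adj U ** U) ** \<rho> ** (mat_adj U ** U)"
    by (simp add: matrix_mul_assoc)
  then show ?thesis
    using assms by (simp add: inner_conj unitary_def)
qed

section \<open>Independent sampling\<close>

lemma finite_lists_of_length: "finite {xs :: 'k::finite list. length xs = n}"
  using finite_lists_length_eq[of "UNIV :: 'k set" n] by simp

lemma sum_lists_Suc:
  "(\<Sum>xs | length xs = Suc n. f xs) =
   (\<Sum>x::'k::finite\<in>UNIV. \<Sum>xs | length xs = n. f (x # xs))"
proof -
  have "{xs :: 'k list. length xs = Suc n} = (\<lambda>(x, xs). x # xs) ` (UNIV \<times> {xs. length xs = n})"
    by (auto simp: length_Suc_conv image_iff)
  then have "(\<Sum>xs | length xs = Suc n. f xs) =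
      (\<Sum>(x, xs)\<in>UNIV \<times> {xs :: 'k list. length xs = n}. f (x # xs))"
    by (simp add: sum.reindex inj_on_def case_prod_unfold)
  then show ?thesis
    by (simp add: sum.cartesian_product)
qed

lemma lists_of_length_0: "{xs. length xs = 0} = {[]}"
  by auto

definition iid :: "('k \<Rightarrow> real) \<Rightarrow> 'k list \<Rightarrow> real" where
  "iid p xs = prod_list (map p xs)"

lemma iid_simps [simp]: "iid p [] = 1" "iid p (x # xs) = p x * iid p xs"
  by (simp_all add: iid_def)

lemma iid_nonneg: "(\<And>x. 0 \<le> p x) \<Longrightarrow> 0 \<le> iid p xs"
  by (induction xs) auto

lemma pmf_replicate_pmf:
  fixes p :: "'k::finite pmf"
  assumes "length xs = n"
  shows "pmf (replicate_pmf n p) xs = iid (pmf p) xs"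
  using assms
proof (induction xs arbitrary: n)
  case Nil
  then show ?case by simp
next
  case (Cons y ys)
  then obtain m where m: "n = Suc m" "length ys = m"
    by auto
  \<comment> \<open>\<open>Cons x\<close> is injective in the tail, and only the head
    \<open>x = y\<close> contributes.\<close>
  have "pmf (map_pmf (Cons x) (replicate_pmf m p)) (y # ys) =
      (if x = y then iid (pmf p) ys else 0)" for x
  proof (cases "x = y")
    case True
    then show ?thesis
      using pmf_map_inj'[of "Cons y" "replicate_pmf m p" ys] Cons.IH[OF m(2)]
      by (simp add: inj_def)
  next
    case False
    then show ?thesis
      by (auto simp: pmf_eq_0_set_pmf)
  qed
  then have "pmf (replicate_pmf n p) (y # ys) =
      (\<Sum>x\<in>UNIV. (if x = y then iid (pmf p) ys else 0) * pmf p x)"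
    by (simp only: m replicate_pmf.simps map_pmf_def[symmetric] pmf_bind)
      (simp add: integral_measure_pmf_real[of UNIV])
  also have "\<dots> = (\<Sum>x\<in>UNIV. if x = y then iid (pmf p) ys * pmf p x else 0)"
    by (rule sum.cong) auto
  finally show ?case
    by simp
qed

lemma expectation_replicate_pmf:
  fixes f :: "'k::finite list \<Rightarrow> 'b::{banach, second_countable_topology}"
  shows "measure_pmf.expectation (replicate_pmf n p) f =
    (\<Sum>xs | length xs = n. iid (pmf p) xs *\<^sub>R f xs)"
proof -
  have "measure_pmf.expectation (replicate_pmf n p) f =
      (\<Sum>xs | length xs = n. pmf (replicate_pmf n p) xs *\<^sub>R f xs)"
    by (rule integral_measure_pmf[OF finite_lists_of_length]) (auto simp: set_replicate_pmf)
  then show ?thesis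
    by (simp add: pmf_replicate_pmf)
qed

lemma sum_iid:
  fixes p :: "'k::finite \<Rightarrow> real"
  assumes "sum p UNIV = 1"
  shows "(\<Sum>xs | length xs = n. iid p xs) = 1"
proof (induction n)
  case 0
  show ?case unfolding lists_of_length_0 by simp
next
  case (Suc n)
  then show ?case
    using assms by (simp add: sum_lists_Suc flip: sum_distrib_left)
qed

lemma sum_iid_sum_list:
  fixes p :: "'k::finite \<Rightarrow> real" and g :: "'k \<Rightarrow> 'b::real_vector"
  assumes "sum p UNIV = 1"
  shows "(\<Sum>xs | length xs = n. iid p xs *\<^sub>R sum_list (map g xs)) =
    real n *\<^sub>R (\<Sum>x\<in>UNIV. p x *\<^sub>R g x)"
proof (induction n)
  case 0
  show ?case unfolding lists_of_length_0 by simp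
next
  case (Suc n)
  let ?S = "\<Sum>xs | length xs = n. iid p xs *\<^sub>R sum_list (map g xs)"
  have "(\<Sum>xs | length xs = n. (p x * iid p xs) *\<^sub>R (g x + sum_list (map g xs))) =
      p x *\<^sub>R g x + p x *\<^sub>R ?S" for x
  proof -
    have "(\<Sum>xs | length xs = n. (p x * iid p xs) *\<^sub>R (g x + sum_list (map g xs))) =
        (\<Sum>xs | length xs = n. iid p xs *\<^sub>R (p x *\<^sub>R g x)) + p x *\<^sub>R ?S"
      by (simp add: scaleR_add_right sum.distrib scaleR_sum_right mult.commute)
    also have "(\<Sum>xs | length xs = n. iid p xs *\<^sub>R (p x *\<^sub>R g x)) = p x *\<^sub>R g x"
      unfolding scaleR_sum_left[symmetric] by (simp add: sum_iid[OF assms])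
    finally show ?thesis .
  qed
  then have "(\<Sum>xs | length xs = Suc n. iid p xs *\<^sub>R sum_list (map g xs)) =
      (\<Sum>x\<in>UNIV. p x *\<^sub>R g x) + ?S"
    using assms by (simp add: sum_lists_Suc sum.distrib flip: scaleR_sum_left)
  then show ?case
    by (simp add: Suc.IH scaleR_add_left)
qed

text \<open>Additivity of variance: in the recursion on the sample size the cross term pairs
  \<open>g x\<close> with the mean of the remaining sum, which is zero.\<close>

lemma sum_iid_norm_sum_list:
  fixes p :: "'k::finite \<Rightarrow> real" and g :: "'k \<Rightarrow> 'b::real_inner"
  assumes "sum p UNIV = 1" "(\<Sum>x\<in>UNIV. p x *\<^sub>R g x) = 0"
  shows "(\<Sum>xs | length xs = n. iid p xs * (norm (sum_list (map g xs)))\<^sup>2) =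
    real n * (\<Sum>x\<in>UNIV. p x * (norm (g x))\<^sup>2)"
proof (induction n)
  case 0
  show ?case unfolding lists_of_length_0 by simp
next
  case (Suc n)
  let ?L = "{xs :: 'k list. length xs = n}"
  let ?S = "\<Sum>xs\<in>?L. iid p xs * (norm (sum_list (map g xs)))\<^sup>2"
  have "(\<Sum>xs\<in>?L. p x * iid p xs * (norm (g x + sum_list (map g xs)))\<^sup>2) =
      p x * (norm (g x))\<^sup>2 + p x * ?S" for x
  proof -
    have "(\<Sum>xs\<in>?L. p x * iid p xs * (norm (g x + sum_list (map g xs)))\<^sup>2) =
        (\<Sum>xs\<in>?L. iid p xs * (p x * (norm (g x))\<^sup>2)
          + 2 * p x * (g x \<bullet> (iid p xs *\<^sub>R sum_list (map g xs)))
          + p x * (iid p xs * (norm (sum_list (map g xs)))\<^sup>2))"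
      by (intro sum.cong refl)
        (simp add: power2_norm_eq_inner inner_add_left inner_add_right inner_commute algebra_simps)
    also have "\<dots> = (\<Sum>xs\<in>?L. iid p xs) * (p x * (norm (g x))\<^sup>2)
        + 2 * p x * (g x \<bullet> (\<Sum>xs\<in>?L. iid p xs *\<^sub>R sum_list (map g xs))) + p x * ?S"
      by (simp only: sum.distrib sum_distrib_left sum_distrib_right inner_sum_right)
    also have "\<dots> = p x * (norm (g x))\<^sup>2 + p x * ?S"
      by (simp add: sum_iid[OF assms(1)] sum_iid_sum_list[OF assms(1)] assms(2))
    finally show ?thesis .
  qed
  then have "(\<Sum>xs | length xs = Suc n. iid p xs * (norm (sum_list (map g xs)))\<^sup>2) =
      (\<Sum>x\<in>UNIV. p x * (norm (g x))\<^sup>2) + ?S"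
    using assms(1) by (simp add: sum_lists_Suc sum.distrib flip: sum_distrib_right)
  then show ?case
    by (simp add: Suc.IH distrib_right)
qed

section \<open>Derivative of the likelihood\<close>

primrec iid_deriv :: "('k \<Rightarrow> real) \<Rightarrow> ('k \<Rightarrow> real) \<Rightarrow> 'k list \<Rightarrow> real" where
  "iid_deriv p \<eta> [] = 0"
| "iid_deriv p \<eta> (x # xs) = \<eta> x * iid p xs + p x * iid_deriv p \<eta> xs"

text \<open>The product rule along the sample. The recursive form avoids quotients by
  \<open>p x\<close>, which may vanish.\<close>

lemma DERIV_iid:
  "((\<lambda>t. iid (\<lambda>x. p x + t * \<eta> x) xs) has_real_derivative iid_deriv p \<eta> xs) (at 0)"
proof (induction xs)
  case (Cons x xs)
  have "((\<lambda>t. p x + t * \<eta> x) has_real_derivative \<eta> x) (at 0)"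
    by (auto intro!: derivative_eq_intros)
  from DERIV_mult[OF this Cons.IH] show ?case
    by (simp add: mult.commute add.commute)
qed simp

lemma iid_deriv_diff:
  "iid_deriv p (\<lambda>x. \<eta> x - \<nu> x) xs = iid_deriv p \<eta> xs - iid_deriv p \<nu> xs"
  by (induction xs) (simp_all add: left_diff_distrib right_diff_distrib)

text \<open>Linearity in the direction, in coordinates: vanishing in all directions reduces to
  finitely many partial derivatives.\<close>

lemma iid_deriv_expand:
  fixes \<eta> :: "'k::finite \<Rightarrow> real"
  shows "iid_deriv p \<eta> xs = (\<Sum>j\<in>UNIV. \<eta> j * iid_deriv p (indicator {j}) xs)"
proof (induction xs)
  case (Cons x xs)
  have "(\<Sum>j\<in>UNIV. \<eta> j * indicator {j} x) = \<eta> x"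
    by (simp add: indicator_def if_distrib cong: if_cong)
  then show ?case
    by (simp add: Cons.IH distrib_left sum.distrib sum_distrib_left mult.left_commute
        flip: sum_distrib_right mult.assoc)
qed simp

text \<open>Euler's identity for a homogeneous function of degree \<open>length xs\<close>.\<close>

lemma iid_deriv_self: "iid_deriv p p xs = iid p xs * real (length xs)"
  by (induction xs) (auto simp: algebra_simps)

text \<open>\<open>g\<close> plays the role of a score: moving \<open>p\<close> in the direction \<open>p * g\<close> multiplies the
  likelihood by the sum of \<open>g\<close> over the sample.\<close>

lemma iid_deriv_score: "iid_deriv p (\<lambda>x. p x * g x) xs = iid p xs * sum_list (map g xs)"
  by (induction xs) (auto simp: algebra_simps)

text \<open>The derivative vanishes in direction \<open>q - p\<close>, and by Euler's identity the
  one along \<open>p\<close> is a multiple of the sum at \<open>t = 0\<close>; together they give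
  direction \<open>q\<close>.\<close>

lemma iid_deriv_segment_eq_0:
  fixes h :: "'k::finite list \<Rightarrow> real"
  assumes "\<And>t. 0 \<le> t \<Longrightarrow> t \<le> 1 \<Longrightarrow> (\<Sum>xs | length xs = n. iid (\<lambda>x. p x + t * (q x - p x)) xs * h xs) = 0"
  shows "(\<Sum>xs | length xs = n. iid_deriv p q xs * h xs) = 0"
proof -
  let ?f = "\<lambda>t. \<Sum>xs | length xs = n. iid (\<lambda>x. p x + t * (q x - p x)) xs * h xs"
  let ?D = "\<Sum>xs | length xs = n. iid_deriv p (\<lambda>x. q x - p x) xs * h xs"
  have "(?f has_real_derivative ?D) (at 0)"
    by (intro DERIV_sum DERIV_cmult_right DERIV_iid)
  \<comment> \<open>Only parameters in [0, 1] are controlled, so derivatives at 0 are compared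
    one-sidedly.\<close>
  then have "(?f has_real_derivative ?D) (at 0 within {0..1})"
    by (rule has_field_derivative_at_within)
  then have "((\<lambda>_. 0) has_real_derivative ?D) (at 0 within {0..1})"
    by (rule has_field_derivative_transform_within[OF _ zero_less_one]) (auto simp: assms)
  moreover have "((\<lambda>_. 0) has_real_derivative 0) (at 0 within {0..1::real})"
    by simp
  ultimately have "?D = 0"
    using vector_derivative_unique_within_closed_interval[of 0 1 0 "\<lambda>_. 0 :: real" ?D 0]
    by (simp add: has_real_derivative_iff_has_vector_derivative)
  moreover have "(\<Sum>xs | length xs = n. iid_deriv p p xs * h xs) = 0"
  proof -
    have "(\<Sum>xs | length xs = n. iid_deriv p p xs * h xs) =
        real n * (\<Sum>xs | length xs = n. iid p xs * h xs)"
      unfolding sum_distrib_left by (rule sum.cong) (auto simp: iid_deriv_self)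
    then show ?thesis
      using assms[of 0] by simp
  qed
  ultimately show ?thesis
    by (simp add: iid_deriv_diff left_diff_distrib sum_subtractf)
qed

text \<open>\<open>embed_pmf\<close> needs nonnegative weights of total mass one: the first holds
  because positive operators have nonnegative inner products, the second by completeness and unit
  trace.\<close>

lemma pmf_outcome_pmf:
  assumes "measurement M" "state \<sigma>"
  shows "pmf (outcome_pmf M \<sigma>) j = M j \<bullet> \<sigma>"
proof -
  have *: "Re (trace (M i ** \<sigma>)) = M i \<bullet> \<sigma>" for i
    using assms by (simp add: inner_hermitian hermitian_state)
  have nn: "0 \<le> M i \<bullet> \<sigma>" for i
    using assms by (auto intro: psd_inner_nonneg simp: measurement_def state_iff)
  have "(\<Sum>i\<in>UNIV. M i \<bullet> \<sigma>) = mat 1 \<bullet> \<sigma>"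
    using assms by (simp add: measurement_def flip: inner_sum_left)
  also have "\<dots> = 1"
    using assms by (simp add: state_iff inner_commute)
  finally have "(\<integral>\<^sup>+i. ennreal (M i \<bullet> \<sigma>) \<partial>count_space UNIV) = 1"
    using nn by (simp add: nn_integral_count_space_finite sum_ennreal flip: ennreal_1)
  then show ?thesis
    unfolding outcome_pmf_def * by (subst pmf_embed_pmf) (auto simp: nn)
qed

lemma expectation_sample_pmf:
  fixes f :: "'k::finite list \<Rightarrow> 'b::{banach, second_countable_topology}"
  assumes "measurement M" "state \<sigma>"
  shows "measure_pmf.expectation (sample_pmf M N \<sigma>) f =
    (\<Sum>xs | length xs = N. iid (\<lambda>j. M j \<bullet> \<sigma>) xs *\<^sub>R f xs)"
proof -
  have "pmf (outcome_pmf M \<sigma>) = (\<lambda>j. M j \<bullet> \<sigma>)"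
    using assms by (auto simp: pmf_outcome_pmf)
  then show ?thesis
    by (simp add: sample_pmf_def expectation_replicate_pmf)
qed

section \<open>Unitary orbits\<close>

text \<open>A finite family stands in for Haar measure, so that orbit averages are finite sums. The
  set collects the rows carrying a minus sign.\<close>

definition signed_perm :: "'n set \<times> ('n \<Rightarrow> 'n) \<Rightarrow> complex^'n^'n" where
  "signed_perm = (\<lambda>(s, \<pi>). \<chi> a b. if b = \<pi> a then (if a \<in> s then -1 else 1) else 0)"

abbreviation signed_perms :: "('n set \<times> ('n \<Rightarrow> 'n)) set" where
  "signed_perms \<equiv> UNIV \<times> {\<pi>. \<pi> permutes UNIV}"

lemma signed_perm_conj:
  "(signed_perm (s, \<pi>) ** A ** mat_adj (signed_perm (s, \<pi>))) $ a $ b =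
    (if a \<in> s then -1 else 1) * (if b \<in> s then -1 else 1) * A $ \<pi> a $ \<pi> b"
proof -
  have 1: "(\<Sum>k\<in>UNIV. (if k = \<pi> i then c else 0) * f k) = c * f (\<pi> i)"
    "(\<Sum>k\<in>UNIV. f k * (if k = \<pi> i then c else 0)) = f (\<pi> i) * c"
    for c :: complex and f i
    by (simp_all add: if_distrib if_distribR cong: if_cong)
  show ?thesis
    by (simp add: signed_perm_def matrix_matrix_mult_def if_distrib[of cnj] 1 cong: if_cong)
qed

lemma unitary_signed_perm:
  assumes "i \<in> signed_perms"
  shows "unitary (signed_perm i)"
proof -
  obtain s \<pi> where i: "i = (s, \<pi>)" and \<pi>: "\<pi> permutes UNIV"
    using assms by auto
  have "(signed_perm i ** mat 1 ** mat_adj (signed_perm i)) $ a $ b = mat 1 $ a $ b" for a b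
    using permutes_inj[OF \<pi>] unfolding i signed_perm_conj by (simp add: mat_def inj_eq)
  then have "signed_perm i ** mat_adj (signed_perm i) = mat 1"
    by (simp add: vec_eq_iff)
  then show ?thesis
    by (simp add: unitary_def matrix_left_right_inverse)
qed

lemma signed_perm_id: "signed_perm ({}, id) = mat 1"
  by (simp add: signed_perm_def mat_def vec_eq_iff)

text \<open>Toggling membership of \<open>a\<close> is an involution on subsets that leaves
  \<open>b\<close> alone and flips every product.\<close>

lemma sum_sign_product:
  fixes a b :: "'n::finite"
  assumes "a \<noteq> b"
  shows "(\<Sum>s\<in>UNIV. (if a \<in> s then -1 else 1) * (if b \<in> s then -1 else (1::complex))) = 0"
    (is "(\<Sum>s\<in>UNIV. ?f s) = 0")
proof -
  define \<phi> where "\<phi> s = (if a \<in> s then s - {a} else insert a s)" for s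
  have inv: "\<phi> (\<phi> s) = s" for s
    by (auto simp: \<phi>_def)
  have "(\<Sum>s\<in>UNIV. ?f s) = (\<Sum>s\<in>UNIV. ?f (\<phi> s))"
    by (rule sum.reindex_bij_witness[of _ \<phi> \<phi>]) (auto simp: inv)
  also have "\<dots> = (\<Sum>s\<in>UNIV. - ?f s)"
    using assms by (intro sum.cong) (auto simp: \<phi>_def)
  finally show ?thesis
    by (simp add: sum_negf)
qed

lemma trace_sum: "trace (sum f I) = (\<Sum>i\<in>I. trace (f i))"
  by (induction I rule: infinite_finite_induct) (auto simp: trace_def sum.distrib)

text \<open>Composition with the transposition of \<open>a\<close> and \<open>b\<close> permutes the
  summands.\<close>

lemma sum_permutations_eval:
  fixes g :: "'n::finite \<Rightarrow> complex"
  shows "(\<Sum>\<pi> | \<pi> permutes UNIV. g (\<pi> a)) = (\<Sum>\<pi> | \<pi> permutes UNIV. g (\<pi> b))"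
proof -
  have "Transposition.transpose a b permutes UNIV"
    by (rule permutes_swap_id) auto
  from sum_permutations_compose_right[OF this, of "\<lambda>\<pi>. g (\<pi> a)"] show ?thesis
    by simp
qed

text \<open>The signed permutation matrices form a unitary 1-design: the signs kill the off-diagonal
  entries and the permutations equalize the diagonal ones.\<close>

lemma sum_signed_perms_conj:
  fixes \<rho> :: "complex^'n^'n"
  assumes "state \<rho>"
  shows "(\<Sum>i\<in>signed_perms. signed_perm i ** \<rho> ** mat_adj (signed_perm i)) =
    (real (card (signed_perms :: ('n set \<times> ('n \<Rightarrow> 'n)) set)) / real CARD('n)) *\<^sub>R mat 1"
    (is "?S = (real ?m / _) *\<^sub>R _")
proof -
  let ?c = "\<lambda>a. of_nat CARD('n set) * (\<Sum>\<pi> | \<pi> permutes UNIV. \<rho> $ \<pi> a $ \<pi> a)"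
  have entry: "?S $ a $ b =
      (\<Sum>s\<in>UNIV. (if a \<in> s then -1 else 1) * (if b \<in> s then -1 else (1::complex))) *
      (\<Sum>\<pi> | \<pi> permutes UNIV. \<rho> $ \<pi> a $ \<pi> b)" for a b
    unfolding sum_component sum_product sum.cartesian_product
    by (rule sum.cong) (auto simp: signed_perm_conj)
  have diag: "?S $ a $ a = ?c a" for a
  proof -
    have "(\<Sum>s\<in>UNIV. (if a \<in> s then -1 else 1) * (if a \<in> s then -1 else (1::complex)))
        = (\<Sum>s\<in>(UNIV :: 'n set set). 1)"
      by (rule sum.cong) auto
    then show ?thesis
      unfolding entry by simp
  qed
  \<comment> \<open>All diagonal entries agree, so an arbitrary index names their common value; the
    trace then determines it.\<close>
  define c where "c = ?c undefined"
  have c: "?c a = c" for a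
    unfolding c_def by (rule arg_cong[OF sum_permutations_eval[of "\<lambda>x. \<rho> $ x $ x"]])
  have S: "?S = (\<chi> a b. if a = b then c else 0)"
    unfolding vec_eq_iff vec_lambda_beta
  proof (intro allI)
    fix a b
    show "?S $ a $ b = (if a = b then c else 0)"
      using diag[of a] c[of a] sum_sign_product[of a b] entry[of a b] by (cases "a = b") simp_all
  qed
  have "trace ?S = of_nat CARD('n) * c"
    by (simp add: S trace_def)
  moreover have "trace ?S = of_nat ?m"
  proof -
    have "trace (signed_perm i ** \<rho> ** mat_adj (signed_perm i)) = 1" if "i \<in> signed_perms" for i
      using state_conj[OF assms unitary_signed_perm[OF that]] by (simp add: state_def)
    then show ?thesis
      unfolding trace_sum by simp
  qed
  ultimately have "c = of_nat ?m / of_nat CARD('n)"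
    by (simp add: field_simps)
  then show ?thesis
    by (simp add: S vec_eq_iff mat_def scaleR_conv_of_real[where 'a = complex])
qed

text \<open>The right side stays a sum of a constant over the same index set, ready for termwise
  comparison.\<close>

lemma sum_signed_perms_inner:
  fixes A \<rho> :: "complex^'n^'n"
  assumes "state \<rho>"
  shows "(\<Sum>i\<in>signed_perms. A \<bullet> (signed_perm i ** \<rho> ** mat_adj (signed_perm i))) =
    (\<Sum>i\<in>(signed_perms :: ('n set \<times> ('n \<Rightarrow> 'n)) set). A \<bullet> mat 1 / real CARD('n))"
  using sum_signed_perms_conj[OF assms] by (simp flip: inner_sum_right)

lemma finite_signed_perms: "finite (signed_perms :: ('n::finite set \<times> ('n \<Rightarrow> 'n)) set)"
  by simp

text \<open>Some value on the orbit is at least the average.\<close>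

lemma ex_unitary_inner_ge:
  fixes A \<rho> :: "complex^'n^'n"
  assumes "state \<rho>"
  shows "\<exists>U. unitary U \<and> A \<bullet> mat 1 / real CARD('n) \<le> A \<bullet> (U ** \<rho> ** mat_adj U)"
proof (rule ccontr)
  assume "\<not> ?thesis"
  then have "A \<bullet> (signed_perm i ** \<rho> ** mat_adj (signed_perm i)) < A \<bullet> mat 1 / real CARD('n)"
    if "i \<in> signed_perms" for i
    using unitary_signed_perm[OF that] by (meson not_le)
  then have "(\<Sum>i\<in>signed_perms. A \<bullet> (signed_perm i ** \<rho> ** mat_adj (signed_perm i))) <
      (\<Sum>i\<in>(signed_perms :: ('n set \<times> ('n \<Rightarrow> 'n)) set). A \<bullet> mat 1 / real CARD('n))"
    using finite_signed_perms permutes_id by (intro sum_strict_mono) (blast | simp)+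
  then show False
    using sum_signed_perms_inner[OF assms] by simp
qed

lemma conj_mat_1: "mat 1 ** A ** mat_adj (mat 1) = (A :: complex^'n^'n)"
proof -
  have "mat_adj (mat 1) = (mat 1 :: complex^'n^'n)"
    using hermitian_mat_1 unfolding hermitian_def .
  then show ?thesis
    by simp
qed

text \<open>The values over the design average to the bound and none exceeds it, so all equal it;
  the design contains the identity.\<close>

lemma inner_const_if_maximal_at_centre:
  fixes A \<rho> :: "complex^'n^'n"
  assumes "\<And>\<sigma>. state \<sigma> \<Longrightarrow> A \<bullet> \<sigma> \<le> A \<bullet> mat 1 / real CARD('n)" "state \<rho>"
  shows "A \<bullet> \<rho> = A \<bullet> mat 1 / real CARD('n)"
proof -
  let ?g = "\<lambda>i. A \<bullet> (signed_perm i ** \<rho> ** mat_adj (signed_perm i))"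
  have le: "?g i \<le> A \<bullet> mat 1 / real CARD('n)" if "i \<in> signed_perms" for i
    using assms(1) state_conj[OF assms(2) unitary_signed_perm[OF that]] by blast
  have "?g ({}, id) = A \<bullet> mat 1 / real CARD('n)"
    by (rule sum_mono_inv[OF sum_signed_perms_inner[OF assms(2)] le])
      (simp_all add: permutes_id)
  then show ?thesis
    by (simp only: signed_perm_id conj_mat_1)
qed

lemma inner_mat_1_mat_1: "(mat 1 :: complex^'n^'n) \<bullet> mat 1 = real CARD('n)"
  by (simp add: inner_mat_1 trace_I)

lemma state_maximally_mixed: "state ((1 / real CARD('n)) *\<^sub>R (mat 1 :: complex^'n^'n))"
  by (simp add: state_iff psd_scaleR psd_mat_1 inner_mat_1_mat_1)

lemma unitary_mat_1: "unitary (mat 1)"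
  using hermitian_mat_1 by (simp add: unitary_def hermitian_def)

section \<open>Attainment of the maximum over a unitary orbit\<close>

lemma continuous_on_conj:
  "continuous_on S (\<lambda>U :: complex^'n^'n. U ** \<rho> ** mat_adj U)"
  unfolding matrix_matrix_mult_def mat_adj_def by (simp, intro continuous_intros)

lemma compact_unitary: "compact {U :: complex^'n^'n. unitary U}"
proof -
  have "norm U \<le> sqrt (real CARD('n))" if "unitary U" for U :: "complex^'n^'n"
  proof -
    have "U \<bullet> U = real CARD('n)"
      using that by (simp add: inner_mat_conv_trace unitary_def trace_I)
    then show ?thesis
      by (simp add: norm_eq_sqrt_inner)
  qed
  then have "bounded {U :: complex^'n^'n. unitary U}"
    by (auto simp: bounded_iff)
  moreover have "closed {U :: complex^'n^'n. unitary U}"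
    unfolding unitary_def Collect_conj_eq
    by (intro closed_Int closed_Collect_eq)
      (auto simp: matrix_matrix_mult_def mat_adj_def intro!: continuous_intros)
  ultimately show ?thesis
    by (simp add: compact_eq_bounded_closed)
qed

lemma continuous_on_iid:
  assumes "\<And>j. continuous_on S (\<lambda>u. p u j)"
  shows "continuous_on S (\<lambda>u. iid (p u) xs)"
  by (induction xs) (auto intro!: continuous_intros assms)

lemma scaled_mse_eq:
  assumes "measurement M" "estimator N est" "state \<sigma>"
  shows "scaled_mse M N est \<sigma> =
    real N * (\<Sum>xs | length xs = N. iid (\<lambda>j. M j \<bullet> \<sigma>) xs * (norm (est xs - \<sigma>))\<^sup>2)"
proof -
  have "Re (trace ((est xs - \<sigma>) ** (est xs - \<sigma>))) = (norm (est xs - \<sigma>))\<^sup>2"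
    if "length xs = N" for xs
    using assms that
    by (simp add: estimator_def hermitian_state hermitian_diff power2_norm_eq_inner
        flip: inner_hermitian)
  then show ?thesis
    by (simp add: scaled_mse_def expectation_sample_pmf assms)
qed

lemma ex_max_scaled_mse:
  fixes M :: "'k::finite \<Rightarrow> complex^'n^'n"
  assumes "measurement M" "estimator N est" "state \<rho>"
  shows "\<exists>m. is_max_scaled_mse M N est \<rho> m"
proof -
  let ?f = "\<lambda>U. scaled_mse M N est (U ** \<rho> ** mat_adj U)"
  \<comment> \<open>The explicit finite sum represents the error only at states, hence continuity is
    transferred on the unitary group alone.\<close>
  have "continuous_on {U. unitary U} ?f"
  proof (rule continuous_on_eq)
    show "continuous_on {U. unitary U} (\<lambda>U. real N * (\<Sum>xs | length xs = N.
        iid (\<lambda>j. M j \<bullet> (U ** \<rho> ** mat_adj U)) xs * (norm (est xs - (U ** \<rho> ** mat_adj U)))\<^sup>2))"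
      by (intro continuous_intros continuous_on_iid continuous_on_conj)
  qed (simp add: scaled_mse_eq assms state_conj)
  then obtain U where "unitary U" "\<And>V. unitary V \<Longrightarrow> ?f V \<le> ?f U"
    using continuous_attains_sup[OF compact_unitary, of ?f] unitary_mat_1 by auto
  then show ?thesis
    unfolding is_max_scaled_mse_def is_arg_max_def by (meson not_le)
qed

lemma is_max_scaled_mse_ge:
  "is_max_scaled_mse M N est \<rho> m \<Longrightarrow> unitary U \<Longrightarrow> scaled_mse M N est (U ** \<rho> ** mat_adj U) \<le> m"
  unfolding is_max_scaled_mse_def is_arg_max_def by (meson not_le)

section \<open>Linear inversion\<close>

text \<open>Expanding one factor of tr(A^2) in the \<open>M j\<close> leaves a combination of the
  vanishing tr(M_j A), so \<open>A\<close> has norm zero.\<close>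

lemma info_complete_eq_0:
  fixes A :: "complex^'n^'n"
  assumes "info_complete M" "hermitian A" "\<And>j. M j \<bullet> A = 0"
  shows "A = 0"
proof -
  have her: "hermitian (M j)" for j
    using assms(1) by (simp add: info_complete_def measurement_def psd_def)
  obtain c where c: "A = (\<Sum>j\<in>UNIV. \<chi> a b. c j * M j $ a $ b)"
    using assms(1) unfolding info_complete_def by blast
  have "trace (A ** A) = trace ((\<Sum>j\<in>UNIV. \<chi> a b. c j * M j $ a $ b) ** A)"
    using c by simp
  also have "\<dots> = (\<Sum>j\<in>UNIV. c j * trace (M j ** A))"
    by (simp add: trace_def matrix_matrix_mult_def sum_distrib_left sum_distrib_right mult.assoc)
      (subst sum.swap, intro sum.cong refl, subst sum.swap, simp)
  also have "\<dots> = 0"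
    by (simp add: trace_mult_hermitian_real her assms)
  finally have "A \<bullet> A = 0"
    by (simp add: inner_hermitian assms)
  then show ?thesis
    by simp
qed

text \<open>Complex coefficient vectors and operators have the same dimension, so the spanning family is
  a basis. The adjoint of the coefficient map then provides dual vectors, whose Hermitian
  parts are still dual to the Hermitian operators \<open>M j\<close>.\<close>

lemma minimal_info_complete_dual:
  fixes M :: "'k::finite \<Rightarrow> complex^'n^'n"
  assumes "minimal_info_complete M"
  obtains \<Theta> where "\<And>k. hermitian (\<Theta> k)" "\<And>j k. M j \<bullet> \<Theta> k = (if j = k then 1 else 0)"
proof -
  have her: "hermitian (M j)" for j
    using assms by (simp add: minimal_info_complete_def info_complete_def measurement_def psd_def)
  define f :: "complex^'k \<Rightarrow> complex^'n^'n"
    where "f c = (\<Sum>j\<in>UNIV. \<chi> a b. c $ j * M j $ a $ b)" for c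
  have "linear f"
    by (rule linearI)
      (simp_all add: f_def vec_eq_iff distrib_right sum.distrib scaleR_sum_right)
  moreover have "surj f"
  proof -
    have "\<exists>c. A = f c" for A
    proof -
      obtain c where "A = (\<Sum>j\<in>UNIV. \<chi> a b. c j * M j $ a $ b)"
        using assms unfolding minimal_info_complete_def info_complete_def by blast
      then show ?thesis
        by (intro exI[of _ "\<chi> j. c j"]) (simp add: f_def)
    qed
    then show ?thesis
      unfolding surj_def by blast
  qed
  moreover have "dim (UNIV :: (complex^'k) set) = dim (UNIV :: (complex^'n^'n) set)"
    using assms by (simp add: minimal_info_complete_def power2_eq_square)
  ultimately have "inj f"
    using eucl.linear_surjective_imp_injective by metis
  then have "surj (adjoint f)"
    using surj_adjoint_iff_inj[OF \<open>linear f\<close>] by simp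
  then have "\<forall>k::'k. \<exists>w. adjoint f w = axis k 1"
    by (metis surjD)
  then obtain v where v: "\<And>k::'k. adjoint f (v k) = axis k 1"
    by metis
  have "f (axis j 1) = M j" for j
  proof -
    have "(\<chi> a b. axis j 1 $ i * M i $ a $ b) = (if i = j then M i else 0)" for i
      by (simp add: axis_def vec_eq_iff)
    then show ?thesis
      by (simp add: f_def)
  qed
  then have Mv: "M j \<bullet> v k = (if j = k then 1 else 0)" for j k
    using adjoint_works[OF \<open>linear f\<close>, of "axis j 1" "v k"] v[of k]
    by (auto simp: inner_axis_axis inner_commute inner_complex_def split: if_splits)
  \<comment> \<open>Taking adjoints is an isometry that fixes each \<open>M j\<close>.\<close>
  have Mv': "M j \<bullet> mat_adj (v k) = M j \<bullet> v k" for j k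
    using inner_mat_adj[of "M j" "v k"] her[of j] by (simp add: hermitian_def)
  show thesis
  proof
    show "hermitian ((1 / 2) *\<^sub>R (v k + mat_adj (v k)))" for k
      by (simp add: hermitian_def vec_eq_iff add.commute)
    show "M j \<bullet> ((1 / 2) *\<^sub>R (v k + mat_adj (v k))) = (if j = k then 1 else 0)" for j k
      by (simp add: inner_add_right Mv' Mv)
  qed
qed

text \<open>The dual operators are the reconstruction operators of linear inversion.\<close>

locale dual_measurement =
  fixes M \<Theta> :: "'k::finite \<Rightarrow> complex^'n^'n"
  assumes minimal: "minimal_info_complete M"
    and hermitian_dual: "hermitian (\<Theta> k)"
    and inner_dual: "M j \<bullet> \<Theta> k = (if j = k then 1 else 0)"
begin

lemma measurement: "measurement M"
  using minimal by (simp add: minimal_info_complete_def info_complete_def)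

lemma psd_M: "psd (M j)"
  using measurement by (simp add: measurement_def)

lemma hermitian_M: "hermitian (M j)"
  using psd_M psd_def by blast

lemma sum_M: "(\<Sum>j\<in>UNIV. M j) = mat 1"
  using measurement by (simp add: measurement_def)

lemma eq_0_if_orthogonal: "hermitian A \<Longrightarrow> (\<And>j. M j \<bullet> A = 0) \<Longrightarrow> A = 0"
  using info_complete_eq_0 minimal minimal_info_complete_def by blast

text \<open>Both sides have the same inner product with every \<open>M k\<close>, so informational
  completeness identifies them.\<close>

lemma dual_expansion:
  assumes "hermitian A"
  shows "(\<Sum>j\<in>UNIV. (M j \<bullet> A) *\<^sub>R \<Theta> j) = A"
proof -
  have "(\<Sum>j\<in>UNIV. (M j \<bullet> A) *\<^sub>R \<Theta> j) - A = 0"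
  proof (rule eq_0_if_orthogonal)
    show "hermitian ((\<Sum>j\<in>UNIV. (M j \<bullet> A) *\<^sub>R \<Theta> j) - A)"
      by (intro hermitian_diff hermitian_sum hermitian_scaleR hermitian_dual assms)
    show "M k \<bullet> ((\<Sum>j\<in>UNIV. (M j \<bullet> A) *\<^sub>R \<Theta> j) - A) = 0" for k
      by (simp add: inner_diff_right inner_sum_right inner_dual if_distrib cong: if_cong)
  qed
  then show ?thesis
    by simp
qed

lemma sum_prob:
  assumes "state \<sigma>"
  shows "(\<Sum>j\<in>UNIV. M j \<bullet> \<sigma>) = 1"
  using assms by (simp add: sum_M state_iff inner_commute[of "mat 1"] flip: inner_sum_left)

text \<open>The combination of the \<open>M j\<close> is Hermitian and vanishes on states, hence is
  zero; pairing with \<open>\<Theta> k\<close> extracts the coefficient.\<close>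

lemma coeffs_eq_0:
  assumes "\<And>\<sigma>. state \<sigma> \<Longrightarrow> (\<Sum>j\<in>UNIV. c j * (M j \<bullet> \<sigma>)) = 0"
  shows "c k = 0"
proof -
  have "(\<Sum>j\<in>UNIV. c j *\<^sub>R M j) = 0"
  proof (rule hermitian_eq_0_if_states)
    show "hermitian (\<Sum>j\<in>UNIV. c j *\<^sub>R M j)"
      by (intro hermitian_sum hermitian_scaleR hermitian_M)
  qed (simp add: inner_sum_left assms)
  then have "(\<Sum>j\<in>UNIV. c j *\<^sub>R M j) \<bullet> \<Theta> k = 0"
    by simp
  then show ?thesis
    by (simp add: inner_sum_left inner_dual if_distrib cong: if_cong)
qed

text \<open>The likelihood is differentiated along the segment from \<open>\<sigma>\<close> to an arbitrary state; since
  states span, the resulting identity extends to all directions.\<close>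

lemma zero_mean_uncorrelated:
  assumes "\<And>\<sigma>. state \<sigma> \<Longrightarrow> (\<Sum>xs | length xs = n. iid (\<lambda>j. M j \<bullet> \<sigma>) xs * h xs) = 0"
    and "state \<sigma>"
  shows "(\<Sum>xs | length xs = n. iid (\<lambda>j. M j \<bullet> \<sigma>) xs * (sum_list (map g xs) * h xs)) = 0"
proof -
  let ?p = "\<lambda>\<sigma> j. M j \<bullet> \<sigma>"
  let ?D = "\<lambda>\<eta>. \<Sum>xs | length xs = n. iid_deriv (?p \<sigma>) \<eta> xs * h xs"
  let ?c = "\<lambda>j. ?D (indicator {j})"
  have expand: "?D \<eta> = (\<Sum>j\<in>UNIV. ?c j * \<eta> j)" for \<eta>
  proof -
    have "?D \<eta> = (\<Sum>xs | length xs = n. \<Sum>j\<in>UNIV. iid_deriv (?p \<sigma>) (indicator {j}) xs * h xs * \<eta> j)"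
      by (subst iid_deriv_expand) (simp add: sum_distrib_left sum_distrib_right mult_ac)
    then show ?thesis
      by (subst (asm) sum.swap) (simp add: sum_distrib_right)
  qed
  have "(\<Sum>j\<in>UNIV. ?c j * ?p \<tau> j) = 0" if "state \<tau>" for \<tau>
  proof -
    have "?D (?p \<tau>) = 0"
    proof (rule iid_deriv_segment_eq_0)
      fix t :: real assume "0 \<le> t" "t \<le> 1"
      then have "state ((1 - t) *\<^sub>R \<sigma> + t *\<^sub>R \<tau>)"
        using state_convex assms(2) that by blast
      moreover have "?p ((1 - t) *\<^sub>R \<sigma> + t *\<^sub>R \<tau>) = (\<lambda>x. ?p \<sigma> x + t * (?p \<tau> x - ?p \<sigma> x))"
        by (auto simp: inner_add_right algebra_simps)
      ultimately show "(\<Sum>xs | length xs = n. iid (\<lambda>x. ?p \<sigma> x + t * (?p \<tau> x - ?p \<sigma> x)) xs * h xs) = 0"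
        using assms(1)[of "(1 - t) *\<^sub>R \<sigma> + t *\<^sub>R \<tau>"] by simp
    qed
    then show ?thesis
      using expand[of "?p \<tau>"] by simp
  qed
  \<comment> \<open>All partial derivatives vanish, so the derivative also vanishes in the score
    direction, which produces the factor \<open>sum_list (map g xs)\<close>.\<close>
  then have "?c j = 0" for j
    by (rule coeffs_eq_0)
  then have "?D (\<lambda>x. ?p \<sigma> x * g x) = 0"
    using expand[of "\<lambda>x. ?p \<sigma> x * g x"] by simp
  then show ?thesis
    by (simp add: iid_deriv_score mult.assoc)
qed

section \<open>Error of linear inversion and its optimality at each state\<close>

definition linear_estimator :: "nat \<Rightarrow> 'k list \<Rightarrow> complex^'n^'n" where
  "linear_estimator N xs = (1 / real N) *\<^sub>R sum_list (map \<Theta> xs)"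

lemma linear_estimator_mean:
  assumes "N \<ge> 1" "state \<sigma>"
  shows "(\<Sum>xs | length xs = N. iid (\<lambda>j. M j \<bullet> \<sigma>) xs *\<^sub>R linear_estimator N xs) = \<sigma>"
proof -
  have "(\<Sum>xs | length xs = N. iid (\<lambda>j. M j \<bullet> \<sigma>) xs *\<^sub>R linear_estimator N xs) =
      (1 / real N) *\<^sub>R (\<Sum>xs | length xs = N. iid (\<lambda>j. M j \<bullet> \<sigma>) xs *\<^sub>R sum_list (map \<Theta> xs))"
    by (simp add: linear_estimator_def scaleR_sum_right)
  then show ?thesis
    using assms(1) by (simp add: sum_iid_sum_list sum_prob assms dual_expansion hermitian_state)
qed

lemma unbiased_linear_estimator:
  assumes "N \<ge> 1"
  shows "unbiased_estimator M N (linear_estimator N)"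
proof -
  have "hermitian (linear_estimator N xs)" for xs
    unfolding linear_estimator_def by (intro hermitian_scaleR hermitian_sum_list hermitian_dual)
  then show ?thesis
    using linear_estimator_mean[OF assms]
    by (simp add: unbiased_estimator_def estimator_def expectation_sample_pmf measurement)
qed

text \<open>Its inner product with a state is the second moment of \<Theta> under a single
  outcome.\<close>

definition frame_op :: "complex^'n^'n" where
  "frame_op = (\<Sum>j\<in>UNIV. (\<Theta> j \<bullet> \<Theta> j) *\<^sub>R M j)"

lemma frame_op_inner: "frame_op \<bullet> A = (\<Sum>j\<in>UNIV. (\<Theta> j \<bullet> \<Theta> j) * (M j \<bullet> A))"
  by (simp add: frame_op_def inner_sum_left)

text \<open>The error is a mean of \<open>N\<close> independent centred terms; scaled by
  \<open>N\<close> it is the variance of one term.\<close>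

lemma linear_estimator_mse:
  assumes "N \<ge> 1" "state \<sigma>"
  shows "real N * (\<Sum>xs | length xs = N. iid (\<lambda>j. M j \<bullet> \<sigma>) xs * (norm (linear_estimator N xs - \<sigma>))\<^sup>2)
    = frame_op \<bullet> \<sigma> - \<sigma> \<bullet> \<sigma>"
proof -
  let ?p = "\<lambda>j. M j \<bullet> \<sigma>"
  let ?g = "\<lambda>j. \<Theta> j - \<sigma>"
  have mean: "(\<Sum>j\<in>UNIV. ?p j *\<^sub>R \<Theta> j) = \<sigma>"
    by (simp add: dual_expansion hermitian_state assms)
  have 0: "(\<Sum>j\<in>UNIV. ?p j *\<^sub>R ?g j) = 0"
    by (simp add: scaleR_diff_right sum_subtractf mean sum_prob assms flip: scaleR_sum_left)
  have "linear_estimator N xs - \<sigma> = (1 / real N) *\<^sub>R sum_list (map ?g xs)" if "length xs = N" for xs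
  proof -
    have "sum_list (map ?g xs) = sum_list (map \<Theta> xs) - real (length xs) *\<^sub>R \<sigma>"
      by (induction xs) (auto simp: algebra_simps)
    then show ?thesis
      using assms(1) that by (simp add: linear_estimator_def scaleR_diff_right)
  qed
  then have "(\<Sum>xs | length xs = N. iid ?p xs * (norm (linear_estimator N xs - \<sigma>))\<^sup>2) =
      (\<Sum>xs | length xs = N. iid ?p xs * (norm (sum_list (map ?g xs)))\<^sup>2) / (real N)\<^sup>2"
    by (simp add: sum_divide_distrib power_divide)
  also have "\<dots> = (\<Sum>j\<in>UNIV. ?p j * (norm (?g j))\<^sup>2) / real N"
    unfolding sum_iid_norm_sum_list[OF sum_prob[OF assms(2)] 0]
    using assms(1) by (simp add: power2_eq_square)
  finally have "real N * (\<Sum>xs | length xs = N. iid ?p xs * (norm (linear_estimator N xs - \<sigma>))\<^sup>2) =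
      (\<Sum>j\<in>UNIV. ?p j * (norm (?g j))\<^sup>2)"
    using assms(1) by simp
  also have "\<dots> = (\<Sum>j\<in>UNIV. (\<Theta> j \<bullet> \<Theta> j) * ?p j - 2 * ((?p j *\<^sub>R \<Theta> j) \<bullet> \<sigma>) + ?p j * (\<sigma> \<bullet> \<sigma>))"
    by (intro sum.cong refl)
      (simp add: power2_norm_eq_inner inner_diff_left inner_diff_right inner_commute algebra_simps)
  also have "\<dots> = frame_op \<bullet> \<sigma> - 2 * ((\<Sum>j\<in>UNIV. ?p j *\<^sub>R \<Theta> j) \<bullet> \<sigma>) + (\<Sum>j\<in>UNIV. ?p j) * (\<sigma> \<bullet> \<sigma>)"
    by (simp only: sum.distrib sum_subtractf frame_op_inner inner_sum_left sum_distrib_left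
        sum_distrib_right)
  finally show ?thesis
    by (simp add: mean sum_prob assms)
qed

lemma scaled_mse_linear_estimator:
  assumes "N \<ge> 1" "state \<sigma>"
  shows "scaled_mse M N (linear_estimator N) \<sigma> = frame_op \<bullet> \<sigma> - \<sigma> \<bullet> \<sigma>"
  using unbiased_linear_estimator[OF assms(1)] linear_estimator_mse[OF assms]
  by (simp add: unbiased_estimator_def scaled_mse_eq measurement assms)

text \<open>Pythagoras: the deviation \<open>?\<delta>\<close> from linear inversion is uncorrelated
  with it and with the constant \<sigma>, so it only adds its own second moment.\<close>

lemma scaled_mse_ge:
  assumes "N \<ge> 1" "unbiased_estimator M N est" "state \<sigma>"
  shows "frame_op \<bullet> \<sigma> - \<sigma> \<bullet> \<sigma> \<le> scaled_mse M N est \<sigma>"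
proof -
  let ?w = "iid (\<lambda>j. M j \<bullet> \<sigma>)"
  let ?L = "linear_estimator N"
  let ?\<delta> = "\<lambda>xs. est xs - ?L xs"
  let ?X = "{xs :: 'k list. length xs = N}"
  have zero: "(\<Sum>xs\<in>?X. iid (\<lambda>j. M j \<bullet> \<tau>) xs *\<^sub>R ?\<delta> xs) = 0" if "state \<tau>" for \<tau>
  proof -
    have "(\<Sum>xs\<in>?X. iid (\<lambda>j. M j \<bullet> \<tau>) xs *\<^sub>R est xs) = \<tau>"
      using assms(2) that by (simp add: unbiased_estimator_def expectation_sample_pmf measurement)
    then show ?thesis
      using linear_estimator_mean[OF assms(1) that]
      by (simp add: scaleR_diff_right sum_subtractf)
  qed
  \<comment> \<open>Real statistics are obtained as components along \<open>b\<close>, with score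
    \<open>\<Theta> j \<bullet> b\<close>; summing over an orthonormal basis recovers the inner
    product.\<close>
  have "(\<Sum>xs\<in>?X. ?w xs * ((?L xs \<bullet> b) * (?\<delta> xs \<bullet> b))) = 0" for b
  proof -
    have "(\<Sum>xs\<in>?X. iid (\<lambda>j. M j \<bullet> \<tau>) xs * (?\<delta> xs \<bullet> b)) = 0" if "state \<tau>" for \<tau>
      using arg_cong[OF zero[OF that], of "\<lambda>v. v \<bullet> b"] by (simp add: inner_sum_left)
    from zero_mean_uncorrelated[OF this assms(3), of "\<lambda>j. \<Theta> j \<bullet> b"]
    have "(\<Sum>xs\<in>?X. ?w xs * (sum_list (map (\<lambda>j. \<Theta> j \<bullet> b) xs) * (?\<delta> xs \<bullet> b))) = 0"
      by simp
    moreover have "sum_list (map (\<lambda>j. \<Theta> j \<bullet> b) xs) = sum_list (map \<Theta> xs) \<bullet> b" for xs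
      by (induction xs) (auto simp: inner_add_left)
    ultimately show ?thesis
      by (simp add: linear_estimator_def sum_divide_distrib[symmetric])
  qed
  then have "(\<Sum>b\<in>Basis. \<Sum>xs\<in>?X. ?w xs * ((?L xs \<bullet> b) * (?\<delta> xs \<bullet> b))) = 0"
    by simp
  moreover have "(\<Sum>xs\<in>?X. ?w xs * (?L xs \<bullet> ?\<delta> xs)) =
      (\<Sum>xs\<in>?X. \<Sum>b\<in>Basis. ?w xs * ((?L xs \<bullet> b) * (?\<delta> xs \<bullet> b)))"
    by (intro sum.cong refl, subst euclidean_inner) (rule sum_distrib_left)
  moreover have "\<dots> = (\<Sum>b\<in>Basis. \<Sum>xs\<in>?X. ?w xs * ((?L xs \<bullet> b) * (?\<delta> xs \<bullet> b)))"
    by (rule sum.swap)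
  ultimately have L\<delta>: "(\<Sum>xs\<in>?X. ?w xs * (?L xs \<bullet> ?\<delta> xs)) = 0"
    by (simp only:)
  have \<sigma>\<delta>: "(\<Sum>xs\<in>?X. ?w xs * (\<sigma> \<bullet> ?\<delta> xs)) = 0"
    using arg_cong[OF zero[OF assms(3)], of "\<lambda>v. \<sigma> \<bullet> v"] by (simp add: inner_sum_right)
  have w: "0 \<le> ?w xs" for xs
    using assms(3) by (intro iid_nonneg psd_inner_nonneg psd_M) (simp add: state_iff)
  have "(\<Sum>xs\<in>?X. ?w xs * (norm (est xs - \<sigma>))\<^sup>2) = (\<Sum>xs\<in>?X.
      ?w xs * (norm (?L xs - \<sigma>))\<^sup>2 + 2 * (?w xs * (?L xs \<bullet> ?\<delta> xs)) - 2 * (?w xs * (\<sigma> \<bullet> ?\<delta> xs))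
      + ?w xs * (norm (?\<delta> xs))\<^sup>2)"
    by (intro sum.cong refl)
      (simp add: power2_norm_eq_inner inner_diff_left inner_diff_right inner_commute algebra_simps)
  also have "\<dots> = (\<Sum>xs\<in>?X. ?w xs * (norm (?L xs - \<sigma>))\<^sup>2) + (\<Sum>xs\<in>?X. ?w xs * (norm (?\<delta> xs))\<^sup>2)"
    by (simp only: sum.distrib sum_subtractf L\<delta> \<sigma>\<delta> sum_distrib_left[symmetric])
  also have "\<dots> \<ge> (\<Sum>xs\<in>?X. ?w xs * (norm (?L xs - \<sigma>))\<^sup>2)"
    by (simp add: sum_nonneg w)
  finally have "real N * (\<Sum>xs\<in>?X. ?w xs * (norm (?L xs - \<sigma>))\<^sup>2) \<le>
      real N * (\<Sum>xs\<in>?X. ?w xs * (norm (est xs - \<sigma>))\<^sup>2)"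
    by (rule mult_left_mono) simp
  then show ?thesis
    using assms by (simp add: linear_estimator_mse scaled_mse_eq measurement unbiased_estimator_def)
qed

end

section \<open>The tomographic bound\<close>

text \<open>Expand the nonnegative sum of \<open>\<parallel>x j - (Z / Y) t j y j\<parallel>\<^sup>2 / t j\<close>; it vanishes in the equality case.\<close>

lemma weighted_Cauchy_Schwarz:
  fixes x y :: "'i \<Rightarrow> 'b::real_inner" and t :: "'i \<Rightarrow> real"
  assumes "finite I" "\<And>j. j \<in> I \<Longrightarrow> t j > 0"
  defines "X \<equiv> \<Sum>j\<in>I. (x j \<bullet> x j) / t j" and "Y \<equiv> \<Sum>j\<in>I. t j * (y j \<bullet> y j)"
    and "Z \<equiv> \<Sum>j\<in>I. x j \<bullet> y j"
  assumes "Y > 0"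
  shows "Z\<^sup>2 \<le> X * Y"
    and "Z\<^sup>2 = X * Y \<Longrightarrow> j \<in> I \<Longrightarrow> x j = (Z / Y * t j) *\<^sub>R y j"
proof -
  define s where "s = Z / Y"
  let ?r = "\<lambda>j. x j - (s * t j) *\<^sub>R y j"
  have "(?r j \<bullet> ?r j) / t j = (x j \<bullet> x j) / t j - 2 * s * (x j \<bullet> y j) + s\<^sup>2 * (t j * (y j \<bullet> y j))"
    if "j \<in> I" for j
    using assms(2)[OF that]
    by (simp add: inner_diff_left inner_diff_right inner_commute field_simps power2_eq_square)
  then have "(\<Sum>j\<in>I. (?r j \<bullet> ?r j) / t j) = X - 2 * s * Z + s\<^sup>2 * Y"
    by (simp add: X_def Y_def Z_def sum.distrib sum_subtractf sum_distrib_left)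
  also have "\<dots> = (X * Y - Z\<^sup>2) / Y"
    using \<open>Y > 0\<close> by (simp add: s_def field_simps power2_eq_square)
  finally have R: "(\<Sum>j\<in>I. (?r j \<bullet> ?r j) / t j) = (X * Y - Z\<^sup>2) / Y" .
  have nonneg: "0 \<le> (?r j \<bullet> ?r j) / t j" if "j \<in> I" for j
    using assms(2)[OF that] by simp
  have "0 \<le> (\<Sum>j\<in>I. (?r j \<bullet> ?r j) / t j)"
    by (rule sum_nonneg) (rule nonneg)
  then show "Z\<^sup>2 \<le> X * Y"
    using \<open>Y > 0\<close> unfolding R by (simp add: zero_le_divide_iff)
  assume "Z\<^sup>2 = X * Y" "j \<in> I"
  then have "(?r j \<bullet> ?r j) / t j = 0"
    using R sum_nonneg_eq_0_iff[OF \<open>finite I\<close> nonneg] by simp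
  then show "x j = (Z / Y * t j) *\<^sub>R y j"
    using assms(2)[OF \<open>j \<in> I\<close>] by (simp add: s_def)
qed

context dual_measurement
begin

section \<open>Traceless parts and the sums entering the Cauchy-Schwarz inequality\<close>

definition weight :: "'k \<Rightarrow> real" where
  "weight j = M j \<bullet> mat 1"

definition traceless_M :: "'k \<Rightarrow> complex^'n^'n" where
  "traceless_M j = M j - (weight j / real CARD('n)) *\<^sub>R mat 1"

text \<open>Every dual operator has trace one (\<open>trace_dual\<close>), so the same multiple of
  the identity is removed from each.\<close>

definition traceless_dual :: "'k \<Rightarrow> complex^'n^'n" where
  "traceless_dual j = \<Theta> j - (1 / real CARD('n)) *\<^sub>R mat 1"

text \<open>Up to the factor d, the second moment at the maximally mixed state.\<close>

definition frame_trace :: real where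
  "frame_trace = frame_op \<bullet> mat 1"

lemma card_outcomes: "real CARD('k) = (real CARD('n))\<^sup>2"
  using minimal by (simp add: minimal_info_complete_def)

lemma trace_dual: "\<Theta> j \<bullet> mat 1 = 1" "mat 1 \<bullet> \<Theta> j = 1"
proof -
  have "mat 1 \<bullet> \<Theta> j = (\<Sum>i\<in>UNIV. M i \<bullet> \<Theta> j)"
    by (simp add: sum_M flip: inner_sum_left)
  then show "mat 1 \<bullet> \<Theta> j = 1"
    by (simp add: inner_dual)
  then show "\<Theta> j \<bullet> mat 1 = 1"
    by (simp add: inner_commute)
qed

lemma trace_M: "M j \<bullet> mat 1 = weight j" "mat 1 \<bullet> M j = weight j"
  by (simp_all add: weight_def inner_commute)

text \<open>Duality makes \<open>M j\<close> nonzero, and a nonzero positive operator has positive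
  trace.\<close>

lemma weight_pos: "weight j > 0"
proof -
  have "M j \<noteq> 0"
    using inner_dual[of j j] by auto
  then have "weight j \<noteq> 0"
    using psd_trace_eq_0 psd_M unfolding weight_def by blast
  moreover have "weight j \<ge> 0"
    unfolding weight_def by (rule psd_inner_nonneg[OF psd_M psd_mat_1])
  ultimately show ?thesis
    by simp
qed

lemma sum_weight: "(\<Sum>j\<in>UNIV. weight j) = real CARD('n)"
  unfolding weight_def by (simp add: sum_M inner_mat_1_mat_1 flip: inner_sum_left)

lemma traceless_M_inner_M:
  "traceless_M j \<bullet> traceless_M k = M j \<bullet> M k - weight j * weight k / real CARD('n)"
  by (simp add: traceless_M_def inner_diff_left inner_diff_right inner_mat_1_mat_1 trace_M)

lemma traceless_M_inner_dual:
  "traceless_M j \<bullet> traceless_dual k = (if j = k then 1 else 0) - weight j / real CARD('n)"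
  by (simp add: traceless_M_def traceless_dual_def inner_diff_left inner_diff_right inner_mat_1_mat_1
      trace_M trace_dual inner_dual)

lemma traceless_dual_inner_dual:
  "traceless_dual j \<bullet> traceless_dual j = \<Theta> j \<bullet> \<Theta> j - 1 / real CARD('n)"
  by (simp add: traceless_dual_def inner_diff_left inner_diff_right inner_mat_1_mat_1
      trace_dual)

text \<open>Trace times purity is squared norm over trace, so this weighting is the one that brings
  in the average purity.\<close>

lemma sum_traceless_M:
  "(\<Sum>j\<in>UNIV. (traceless_M j \<bullet> traceless_M j) / weight j) = real CARD('n) * average_purity M - 1"
proof -
  have "Re (trace (M j)) * purity (M j) = (M j \<bullet> M j) / weight j" for j
    using weight_pos[of j]
    by (simp add: purity_def weight_def inner_hermitian[OF hermitian_M] inner_mat_1 power2_eq_square)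
  then have "real CARD('n) * average_purity M = (\<Sum>j\<in>UNIV. (M j \<bullet> M j) / weight j)"
    by (simp add: average_purity_def)
  moreover have "(traceless_M j \<bullet> traceless_M j) / weight j =
      (M j \<bullet> M j) / weight j - weight j / real CARD('n)" for j
    using weight_pos[of j] by (simp add: traceless_M_inner_M diff_divide_distrib)
  ultimately show ?thesis
    by (simp add: sum_subtractf sum_weight flip: sum_divide_distrib)
qed

lemma sum_traceless_dual:
  "(\<Sum>j\<in>UNIV. weight j * (traceless_dual j \<bullet> traceless_dual j)) = frame_trace - 1"
proof -
  have "(\<Sum>j\<in>UNIV. weight j * (traceless_dual j \<bullet> traceless_dual j)) =
      frame_trace - (\<Sum>j\<in>UNIV. weight j) / real CARD('n)"
    by (simp add: traceless_dual_inner_dual right_diff_distrib sum_subtractf sum_divide_distrib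
        frame_trace_def frame_op_inner mult.commute flip: weight_def)
  then show ?thesis
    by (simp add: sum_weight)
qed

text \<open>The value is the dimension of the space of traceless Hermitian operators.\<close>

lemma sum_traceless_M_dual:
  "(\<Sum>j\<in>UNIV. traceless_M j \<bullet> traceless_dual j) = (real CARD('n))\<^sup>2 - 1"
  by (simp add: traceless_M_inner_dual sum_subtractf card_outcomes sum_weight flip: sum_divide_distrib)

text \<open>The part of \<open>mse_bound\<close> that does not depend on the state.\<close>

definition centre_bound :: real where
  "centre_bound = ((real CARD('n))\<^sup>2 - 1)\<^sup>2 / ((real CARD('n))\<^sup>2 * average_purity M - real CARD('n))
    + 1 / real CARD('n)"

lemma mse_bound_eq:
  assumes "state \<rho>"
  shows "mse_bound M \<rho> = centre_bound - \<rho> \<bullet> \<rho>"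
  by (simp add: mse_bound_def centre_bound_def inner_hermitian hermitian_state assms)

context
  assumes dim_ge_2: "CARD('n) \<ge> 2"
begin

text \<open>Otherwise every traceless dual part would vanish, and with it the pairing sum d^2 -
  1.\<close>

lemma frame_trace_gt_1: "frame_trace > 1"
proof (rule ccontr)
  assume "\<not> frame_trace > 1"
  moreover have nn: "0 \<le> weight j * (traceless_dual j \<bullet> traceless_dual j)" for j
    using weight_pos[of j] by simp
  moreover have "0 \<le> (\<Sum>j\<in>UNIV. weight j * (traceless_dual j \<bullet> traceless_dual j))"
    by (rule sum_nonneg) (rule nn)
  ultimately have "(\<Sum>j\<in>UNIV. weight j * (traceless_dual j \<bullet> traceless_dual j)) = 0"
    by (simp add: sum_traceless_dual)
  then have "weight j * (traceless_dual j \<bullet> traceless_dual j) = 0" for j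
    using nn by (simp add: sum_nonneg_eq_0_iff)
  then have "traceless_dual j = 0" for j
    using weight_pos[of j] by (metis inner_eq_zero_iff less_irrefl mult_eq_0_iff)
  then have "(real CARD('n))\<^sup>2 = 1"
    using sum_traceless_M_dual by simp
  then show False
    using dim_ge_2 by (simp add: power2_eq_1_iff)
qed

lemma Cauchy_Schwarz_bound:
  "((real CARD('n))\<^sup>2 - 1)\<^sup>2 \<le> (real CARD('n) * average_purity M - 1) * (frame_trace - 1)"
  using weighted_Cauchy_Schwarz(1)[of UNIV weight traceless_dual traceless_M] weight_pos frame_trace_gt_1
  by (simp add: sum_traceless_dual sum_traceless_M_dual sum_traceless_M)

text \<open>The left side of the Cauchy-Schwarz bound is strictly positive, so both factors on the
  right are.\<close>

lemma purity_pos: "real CARD('n) * average_purity M - 1 > 0"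
proof -
  have "(real CARD('n))\<^sup>2 \<noteq> 1"
    using dim_ge_2 by (simp add: power2_eq_1_iff)
  then have "0 < ((real CARD('n))\<^sup>2 - 1)\<^sup>2"
    by simp
  then have "0 < (real CARD('n) * average_purity M - 1) * (frame_trace - 1)"
    using Cauchy_Schwarz_bound by linarith
  then show ?thesis
    using frame_trace_gt_1 by (simp add: zero_less_mult_iff)
qed

lemma centre_bound_conv:
  "centre_bound = (((real CARD('n))\<^sup>2 - 1)\<^sup>2 / (real CARD('n) * average_purity M - 1) + 1) / real CARD('n)"
proof -
  have "(real CARD('n))\<^sup>2 * average_purity M - real CARD('n) =
      real CARD('n) * (real CARD('n) * average_purity M - 1)"
    by (simp add: power2_eq_square algebra_simps)
  then show ?thesis
    by (simp add: centre_bound_def add_divide_distrib mult.commute)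
qed

lemma centre_bound_le: "centre_bound \<le> frame_trace / real CARD('n)"
proof -
  have "((real CARD('n))\<^sup>2 - 1)\<^sup>2 / (real CARD('n) * average_purity M - 1) \<le> frame_trace - 1"
    using Cauchy_Schwarz_bound purity_pos by (simp add: pos_divide_le_eq mult.commute)
  then show ?thesis
    unfolding centre_bound_conv by (intro divide_right_mono) auto
qed

text \<open>Translates tightness at the centre into equality in Cauchy-Schwarz, for both directions
  of the saturation claim.\<close>

lemma centre_bound_eq_iff:
  "centre_bound = frame_trace / real CARD('n) \<longleftrightarrow>
    ((real CARD('n))\<^sup>2 - 1)\<^sup>2 = (real CARD('n) * average_purity M - 1) * (frame_trace - 1)"
proof -
  have "centre_bound = frame_trace / real CARD('n) \<longleftrightarrow>
      ((real CARD('n))\<^sup>2 - 1)\<^sup>2 / (real CARD('n) * average_purity M - 1) = frame_trace - 1"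
    by (auto simp: centre_bound_conv)
  then show ?thesis
    using purity_pos by (simp add: nonzero_divide_eq_eq mult.commute)
qed

section \<open>The bound and its saturation\<close>

lemma max_scaled_mse_ge:
  assumes "N \<ge> 1" "unbiased_estimator M N est" "state \<rho>"
  shows "\<exists>m. is_max_scaled_mse M N est \<rho> m \<and> mse_bound M \<rho> \<le> m"
proof -
  obtain m where m: "is_max_scaled_mse M N est \<rho> m"
    using ex_max_scaled_mse measurement assms unfolding unbiased_estimator_def by blast
  \<comment> \<open>The purity of the state is constant on the orbit, so it suffices to make the
    \<open>frame_op\<close> term at least its average.\<close>
  obtain U where U: "unitary U" "frame_trace / real CARD('n) \<le> frame_op \<bullet> (U ** \<rho> ** mat_adj U)"
    using ex_unitary_inner_ge[OF assms(3)] unfolding frame_trace_def by blast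
  have "mse_bound M \<rho> \<le> frame_op \<bullet> (U ** \<rho> ** mat_adj U) - \<rho> \<bullet> \<rho>"
    using U centre_bound_le by (simp add: mse_bound_eq assms)
  also have "\<dots> \<le> scaled_mse M N est (U ** \<rho> ** mat_adj U)"
    using scaled_mse_ge[OF assms(1,2) state_conj[OF assms(3) U(1)]] by (simp add: inner_conj_unitary U)
  also have "\<dots> \<le> m"
    using is_max_scaled_mse_ge[OF m U(1)] .
  finally show ?thesis
    using m by blast
qed

text \<open>Saturation bounds \<open>frame_op\<close> from above at every state, Cauchy-Schwarz
  bounds it from below at the maximally mixed one; hence it is constant on states and Cauchy-Schwarz
  is tight.\<close>

lemma saturated_imp_generalized_SIC:
  assumes "N \<ge> 1" "unbiased_estimator M N est"
    and sat: "\<And>\<rho>. state \<rho> \<Longrightarrow> is_max_scaled_mse M N est \<rho> (mse_bound M \<rho>)"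
  shows "generalized_SIC M"
proof -
  define d where "d = real CARD('n)"
  have d: "d > 0"
    by (simp add: d_def)
  have le: "frame_op \<bullet> \<sigma> \<le> centre_bound" if "state \<sigma>" for \<sigma>
  proof -
    have "scaled_mse M N est \<sigma> \<le> mse_bound M \<sigma>"
      using is_max_scaled_mse_ge[OF sat[OF that] unitary_mat_1] by (simp only: conj_mat_1)
    then show ?thesis
      using scaled_mse_ge[OF assms(1,2) that] by (simp add: mse_bound_eq that)
  qed
  have eq: "centre_bound = frame_trace / d"
    using le[OF state_maximally_mixed] centre_bound_le by (simp add: frame_trace_def d_def)
  have "frame_op \<bullet> \<sigma> = centre_bound" if "state \<sigma>" for \<sigma>
    using inner_const_if_maximal_at_centre[of frame_op \<sigma>] le that eq
    by (simp add: frame_trace_def d_def)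
  \<comment> \<open>Probabilities sum to one, so the constant is absorbed into the coefficients;
    their vanishing fixes every dual norm.\<close>
  then have "(\<Sum>j\<in>UNIV. (\<Theta> j \<bullet> \<Theta> j - centre_bound) * (M j \<bullet> \<sigma>)) = 0" if "state \<sigma>" for \<sigma>
    using that sum_prob[OF that]
    by (simp add: left_diff_distrib sum_subtractf frame_op_inner flip: sum_distrib_left)
  from coeffs_eq_0[OF this] have const: "\<Theta> j \<bullet> \<Theta> j = centre_bound" for j
    by simp
  \<comment> \<open>The ratio \<open>Z / Y\<close> from the equality case of Cauchy-Schwarz.\<close>
  define s where "s = (d\<^sup>2 - 1) / (frame_trace - 1)"
  have proportional: "traceless_M j = (s * weight j) *\<^sub>R traceless_dual j" for j
    using weighted_Cauchy_Schwarz(2)[of UNIV weight traceless_dual traceless_M j] weight_pos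
      frame_trace_gt_1 eq
    unfolding d_def s_def centre_bound_eq_iff
    by (simp add: sum_traceless_dual sum_traceless_M_dual sum_traceless_M)
  \<comment> \<open>The reciprocal of the common weight, found by solving the diagonal duality
    relation for \<open>weight j\<close>.\<close>
  define w where "w = s * (centre_bound - 1 / d) + 1 / d"
  have weight_w': "weight j * w = 1" for j
  proof -
    have "1 - weight j / d = (s * weight j) * (centre_bound - 1 / d)"
      using traceless_M_inner_dual[of j j] unfolding proportional
      by (simp add: traceless_dual_inner_dual const d_def)
    then show ?thesis
      by (simp add: w_def algebra_simps)
  qed
  have w0: "w \<noteq> 0"
    using weight_w'[of undefined] by auto
  then have weight_w: "weight j = 1 / w" for j
    using weight_w'[of j] by (simp add: eq_divide_eq)
  have "d * w = d * d"
    using sum_weight w0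
    by (auto simp: weight_w card_outcomes d_def[symmetric] power2_eq_square field_simps)
  then have weight: "weight j = 1 / d" for j
    using d by (simp add: weight_w)
  \<comment> \<open>Proportionality trades one traceless factor for a dual one, and duality makes
    the Gram matrix explicit.\<close>
  have "M j \<bullet> M k = (s / d) * ((if j = k then 1 else 0) - 1 / d\<^sup>2) + 1 / d ^ 3" for j k
  proof -
    have "M j \<bullet> M k = traceless_M j \<bullet> traceless_M k + 1 / d ^ 3"
      by (simp add: traceless_M_inner_M weight d_def[symmetric] power3_eq_cube)
    also have "traceless_M j \<bullet> traceless_M k = (s / d) * (traceless_M j \<bullet> traceless_dual k)"
      by (simp add: proportional[of k] weight)
    finally show ?thesis
      by (simp add: traceless_M_inner_dual weight d_def[symmetric] power2_eq_square)
  qed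
  then have "d\<^sup>2 * (M j \<bullet> M k) = (s * d) * (if j = k then 1 else 0) + (1 - s) / d" for j k
    using d by (simp add: field_simps power2_eq_square power3_eq_cube)
  moreover have "trace (d *\<^sub>R M j ** d *\<^sub>R M k) = complex_of_real (d\<^sup>2 * (M j \<bullet> M k))" for j k
    by (subst trace_mult_hermitian_real)
      (simp_all add: hermitian_scaleR hermitian_M power2_eq_square)
  ultimately have "\<forall>j k. trace (d *\<^sub>R M j ** d *\<^sub>R M k) =
      complex_of_real (s * d * (if j = k then 1 else 0) + (1 - s) / d)"
    by simp
  moreover have "M j = (1 / d) *\<^sub>R (d *\<^sub>R M j)" for j
    using d by simp
  ultimately show ?thesis
    using minimal unfolding generalized_SIC_def minimal_info_complete_def d_def[symmetric]
    by (intro conjI exI[of _ "\<lambda>j. d *\<^sub>R M j"] exI[of _ "s * d"] exI[of _ "(1 - s) / d"]) blast+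
qed

text \<open>For a generalized SIC measurement \<open>\<Theta> j = a M\<^sub>j + b 1\<close>, so all dual operators have the same norm
  and Cauchy--Schwarz is an equality.\<close>

lemma generalized_SIC_frame_op:
  assumes "generalized_SIC M"
  shows "centre_bound = frame_trace / real CARD('n)"
    and "state \<sigma> \<Longrightarrow> frame_op \<bullet> \<sigma> = centre_bound"
proof -
  define d where "d = real CARD('n)"
  have d: "d > 0" "d\<^sup>2 > 1"
    using dim_ge_2 by (simp_all add: d_def)
  obtain P \<alpha> \<zeta> where P: "\<And>j. M j = (1 / d) *\<^sub>R P j"
    and tr: "\<And>j k. trace (P j ** P k) = complex_of_real (\<alpha> * (if j = k then 1 else 0) + \<zeta>)"
    using assms unfolding generalized_SIC_def d_def by blast
  have gram: "M j \<bullet> M k = (\<alpha> * (if j = k then 1 else 0) + \<zeta>) / d\<^sup>2" for j k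
  proof -
    have "P k = d *\<^sub>R M k"
      using P[of k] d by simp
    then have "hermitian (P k)"
      by (simp only: hermitian_scaleR hermitian_M)
    then have "P j \<bullet> P k = \<alpha> * (if j = k then 1 else 0) + \<zeta>"
      by (simp only: inner_hermitian tr Re_complex_of_real)
    then show ?thesis
      by (simp add: P power2_eq_square)
  qed
  \<comment> \<open>A row sum of the Gram matrix is a trace by completeness, and all row sums
    agree.\<close>
  have "weight j = (\<alpha> + d\<^sup>2 * \<zeta>) / d\<^sup>2" for j
  proof -
    have "weight j = (\<Sum>k\<in>UNIV. M j \<bullet> M k)"
      by (simp add: weight_def sum_M flip: inner_sum_right)
    also have "\<dots> = (\<Sum>k\<in>UNIV. \<alpha> * (if j = k then 1 else 0) + \<zeta>) / d\<^sup>2"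
      unfolding gram sum_divide_distrib ..
    also have "(\<Sum>k\<in>UNIV. \<alpha> * (if j = k then 1 else 0) + \<zeta>) = \<alpha> + d\<^sup>2 * \<zeta>"
      by (simp add: sum.distrib card_outcomes d_def flip: sum_distrib_left)
    finally show ?thesis .
  qed
  then obtain t where t: "weight j = t" for j
    by blast
  have "d\<^sup>2 * t = d"
    using sum_weight by (simp add: t card_outcomes d_def)
  then have weight: "weight j = 1 / d" for j
    using d by (simp add: t power2_eq_square field_simps)
  \<comment> \<open>Otherwise all \<open>M j\<close> would be at distance zero from each other,
    contradicting duality for two distinct outcomes.\<close>
  have "\<alpha> \<noteq> 0"
  proof
    assume "\<alpha> = 0"
    then have eq: "M j = M k" for j k
    proof -
      have "(M j - M k) \<bullet> (M j - M k) = 0"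
        using \<open>\<alpha> = 0\<close> by (simp add: inner_diff_left inner_diff_right gram)
      then show ?thesis
        by simp
    qed
    have "real CARD('k) > 1"
      using d by (simp add: card_outcomes d_def)
    then have "\<not> is_singleton (UNIV :: 'k set)"
      by (simp add: is_singleton_altdef)
    then obtain j k :: 'k where "j \<noteq> k"
      by (metis UNIV_I UNIV_eq_I insertI1 is_singletonI singletonD)
    then show False
      using inner_dual[of j j] inner_dual[of k j] eq[of j k] by simp
  qed
  \<comment> \<open>Solved from the requirement that
    \<open>a *\<^sub>R M j + b *\<^sub>R mat 1\<close> has product 1 with \<open>M j\<close> and 0
    with the others.\<close>
  define a b where "a = d\<^sup>2 / \<alpha>" and "b = - \<zeta> * d / \<alpha>"
  have dual: "\<Theta> j = a *\<^sub>R M j + b *\<^sub>R mat 1" for j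
  proof -
    have "\<Theta> j - (a *\<^sub>R M j + b *\<^sub>R mat 1) = 0"
    proof (rule eq_0_if_orthogonal)
      show "hermitian (\<Theta> j - (a *\<^sub>R M j + b *\<^sub>R mat 1))"
        by (intro hermitian_diff hermitian_add hermitian_scaleR hermitian_dual hermitian_M hermitian_mat_1)
      show "M k \<bullet> (\<Theta> j - (a *\<^sub>R M j + b *\<^sub>R mat 1)) = 0" for k
        using \<open>\<alpha> \<noteq> 0\<close> d weight[of k]
        by (auto simp: inner_diff_right inner_add_right inner_dual gram weight_def a_def b_def
            field_simps power2_eq_square)
    qed
    then show ?thesis
      by simp
  qed
  have a: "a \<noteq> 0"
    using \<open>\<alpha> \<noteq> 0\<close> d by (simp add: a_def)
  have ab: "a / d + b * d = 1"
    using trace_dual(1)[of undefined] weight[of undefined]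
    by (simp add: dual inner_add_left inner_mat_1_mat_1 weight_def d_def)
  have norm: "\<Theta> j \<bullet> \<Theta> j = a + b" for j
  proof -
    have "\<Theta> j \<bullet> \<Theta> j = (a *\<^sub>R M j + b *\<^sub>R mat 1) \<bullet> \<Theta> j"
      by (simp flip: dual)
    also have "\<dots> = a + b"
      using inner_dual[of j j] trace_dual(2)[of j] by (simp add: inner_add_left)
    finally show ?thesis .
  qed
  have frame: "frame_op \<bullet> A = (a + b) * (mat 1 \<bullet> A)" for A
    by (simp add: frame_op_inner norm sum_M flip: sum_distrib_left inner_sum_left)
  have proportional: "traceless_dual j = a *\<^sub>R traceless_M j" for j
  proof -
    have "b - 1 / d = - a / (d * d)"
      using arg_cong[OF ab, of "\<lambda>c. c / d"] d by (simp add: add_divide_distrib)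
    then have "(b - 1 / d) *\<^sub>R mat 1 = (- a / (d * d)) *\<^sub>R (mat 1 :: complex^'n^'n)"
      by simp
    then show ?thesis
      by (simp add: traceless_dual_def traceless_M_def dual weight d_def[symmetric] algebra_simps)
  qed
  \<comment> \<open>Proportionality makes consecutive Cauchy-Schwarz sums differ by the same factor
    \<open>d / a\<close>, which forces equality.\<close>
  have Z: "d\<^sup>2 - 1 = (frame_trace - 1) * (d / a)"
  proof -
    have "traceless_M j \<bullet> traceless_dual j = weight j * (traceless_dual j \<bullet> traceless_dual j) * (d / a)" for j
      using a d by (simp add: proportional weight)
    then show ?thesis
      unfolding d_def sum_traceless_M_dual[symmetric] sum_traceless_dual[symmetric] sum_distrib_right
      by (intro sum.cong refl)
  qed
  have X: "d * average_purity M - 1 = (d\<^sup>2 - 1) * (d / a)"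
  proof -
    have "(traceless_M j \<bullet> traceless_M j) / weight j = (traceless_M j \<bullet> traceless_dual j) * (d / a)" for j
      using a d by (simp add: proportional weight)
    then show ?thesis
      unfolding d_def sum_traceless_M_dual[symmetric] sum_traceless_M[symmetric] sum_distrib_right
      by (intro sum.cong refl)
  qed
  have "(d\<^sup>2 - 1)\<^sup>2 = (d\<^sup>2 - 1) * ((frame_trace - 1) * (d / a))"
    unfolding power2_eq_square[of "d\<^sup>2 - 1"] using Z by (rule arg_cong)
  also have "\<dots> = (d * average_purity M - 1) * (frame_trace - 1)"
    by (simp add: X)
  finally show eq: "centre_bound = frame_trace / real CARD('n)"
    unfolding centre_bound_eq_iff d_def .
  have "frame_trace = (a + b) * d"
    by (simp add: frame_trace_def frame inner_mat_1_mat_1 d_def)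
  then have "centre_bound = a + b"
    using eq d by (simp add: d_def)
  then show "frame_op \<bullet> \<sigma> = centre_bound" if "state \<sigma>"
    using that by (simp add: frame state_iff inner_commute[of "mat 1"])
qed

text \<open>The error of linear inversion is constant on the orbit, so every unitary is a
  maximiser.\<close>

lemma generalized_SIC_imp_saturated:
  assumes "generalized_SIC M" "N \<ge> 1" "state \<rho>"
  shows "is_max_scaled_mse M N (linear_estimator N) \<rho> (mse_bound M \<rho>)"
proof -
  have "scaled_mse M N (linear_estimator N) (U ** \<rho> ** mat_adj U) = mse_bound M \<rho>" if "unitary U" for U
    unfolding scaled_mse_linear_estimator[OF assms(2) state_conj[OF assms(3) that]]
      generalized_SIC_frame_op(2)[OF assms(1) state_conj[OF assms(3) that]]
      mse_bound_eq[OF assms(3)] inner_conj_unitary[OF that] ..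
  then show ?thesis
    unfolding is_max_scaled_mse_def is_arg_max_def using unitary_mat_1 by (metis less_irrefl)
qed

end

end

theorem theorem3:
  fixes M :: "'k::finite \<Rightarrow> complex^'n^'n" and N :: nat
  assumes "CARD('n) \<ge> 2"
    and "minimal_info_complete M"
    and "N \<ge> 1"
  shows "(\<forall>est \<rho>. unbiased_estimator M N est \<longrightarrow> state \<rho> \<longrightarrow>
            (\<exists>m. is_max_scaled_mse M N est \<rho> m \<and> mse_bound M \<rho> \<le> m))
       \<and> ((\<exists>est. unbiased_estimator M N est \<and>
              (\<forall>\<rho>. state \<rho> \<longrightarrow> is_max_scaled_mse M N est \<rho> (mse_bound M \<rho>)))
          \<longleftrightarrow> generalized_SIC M)"
proof -
  obtain \<Theta> where \<Theta>: "\<And>k. hermitian (\<Theta> k)" "\<And>j k. M j \<bullet> \<Theta> k = (if j = k then 1 else 0)"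
    using minimal_info_complete_dual[OF assms(2)] by blast
  interpret dual_measurement M \<Theta>
    by unfold_locales (use assms(2) \<Theta> in auto)
  show ?thesis
    using max_scaled_mse_ge[OF assms(1,3)] saturated_imp_generalized_SIC[OF assms(1,3)]
      generalized_SIC_imp_saturated[OF assms(1) _ assms(3)] unbiased_linear_estimator[OF assms(3)]
    by blast
qed

end
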